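(* The following assignments define $k$-algebra homomorphisms $\rho_j:S\to M_2(k)$, $j=0,1,2,3$: $\rho_0$: $(x_0,x_1,x_2,x_3)\mapsto(1,\;q_1,\;q_2,\;q_3)$; $\rho_1$: $(x_0,x_1,x_2,x_3)\mapsto(bc\,q_1,\;-\mathbf i,\;-\mathbf ib\,q_3,\;-c\,q_2)$; $\rho_2$: $(x_0,x_1,x_2,x_3)\mapsto(ac\,q_2,\;-a\,q_3,\;-\mathbf i,\;-\mathbf ic\,q_1)$; $\rho_3$: $(x_0,x_1,x_2,x_3)\mapsto(ab\,q_3,\;-\mathbf ia\,q_2,\;-b\,q_1,\;-\mathbf i)$. The $\rho_j$ are the structure maps of four pairwise non-isomorphic 2-dimensional simple left $S$-modules, denoted $V(\tau+\xi_j)$ ($j=0,1,2,3$, with $V(\tau+\xi_0)=V(\tau)$). If $1\le j\le3$, then $V(\tau+\xi_j)\cong\phi_j^*V(\tau)$.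
   Context: Let $k$ be an algebraically closed field of characteristic $\neq2,3$; $\alpha_1,\alpha_2,\alpha_3\in k\setminus\{0,1,-1\}$ with $\alpha_1+\alpha_2+\alpha_3+\alpha_1\alpha_2\alpha_3=0$; fix $a,b,c,\mathbf i\in k$ with $a^2=\alpha_1$, $b^2=\alpha_2$, $c^2=\alpha_3$, $\mathbf i^2=-1$. $S$ is the 4-dimensional Sklyanin algebra: the $k$-algebra generated by $x_0,\dots,x_3$ with relations $x_0x_i-x_ix_0=\alpha_i(x_jx_k+x_kx_j)$ and $x_0x_i+x_ix_0=x_jx_k-x_kx_j$ for all cyclic permutations $(i,j,k)$ of $(1,2,3)$. $q_1=\begin{pmatrix}\mathbf i&0\\0&-\mathbf i\end{pmatrix}$, $q_2=\begin{pmatrix}0&\mathbf i\\\mathbf i&0\end{pmatrix}$, $q_3=\begin{pmatrix}0&-1\\1&0\end{pmatrix}$; scalars in $M_2(k)$ denote scalar matrices. $\phi_1,\phi_2,\phi_3$ are the $k$-algebra automorphisms of $S$ with $\phi_1$: $x_0\mapsto bc\,x_1$, $x_1\mapsto-\mathbf ix_0$, $x_2\mapsto-\mathbf ib\,x_3$, $x_3\mapsto-c\,x_2$; $\phi_2$: $x_0\mapsto ac\,x_2$, $x_1\mapsto-a\,x_3$, $x_2\mapsto-\mathbf ix_0$, $x_3\mapsto-\mathbf ic\,x_1$; $\phi_3$: $x_0\mapsto ab\,x_3$, $x_1\mapsto-\mathbf ia\,x_2$, $x_2\mapsto-b\,x_1$, $x_3\mapsto-\mathbf ix_0$. For an automorphism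 $\psi$ and a left module $M$, $\psi^*M$ is $M$ with new action $x\cdot m:=\psi(x)m$. The symbols $\tau+\xi_j$ are here only labels. *)

theory Defs
  imports
    "Jordan_Normal_Form.VS_Connect"
    "HOL-Algebra.QuotRing"
    "HOL-Library.Poly_Mapping"
begin

section \<open>Algebras over a field\<close>

text \<open>
  A \<open>k\<close>-algebra is a record of type \<^typ>\<open>('k, 'a) module\<close>: a ring together with a scalar
  multiplication by the field \<^typ>\<open>'k\<close>.  The library locale \<^locale>\<open>algebra\<close> is not usable here,
  since it asks for a commutative ring.
\<close>

locale k_algebra = ring A for A :: "('k::field, 'a) module" (structure) +
  assumes smult_closed: "x \<in> carrier A \<Longrightarrow> s \<odot> x \<in> carrier A"
    and smult_l_distr: "x \<in> carrier A \<Longrightarrow> (s + t) \<odot> x = s \<odot> x \<oplus> t \<odot> x"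
    and smult_r_distr: "x \<in> carrier A \<Longrightarrow> y \<in> carrier A \<Longrightarrow> s \<odot> (x \<oplus> y) = s \<odot> x \<oplus> s \<odot> y"
    and smult_assoc1: "x \<in> carrier A \<Longrightarrow> (s * t) \<odot> x = s \<odot> (t \<odot> x)"
    and smult_one: "x \<in> carrier A \<Longrightarrow> 1 \<odot> x = x"
    and smult_mult_l: "x \<in> carrier A \<Longrightarrow> y \<in> carrier A \<Longrightarrow> (s \<odot> x) \<otimes> y = s \<odot> (x \<otimes> y)"
    and smult_mult_r: "x \<in> carrier A \<Longrightarrow> y \<in> carrier A \<Longrightarrow> x \<otimes> (s \<odot> y) = s \<odot> (x \<otimes> y)"

definition alg_hom :: "('k, 'a) module \<Rightarrow> ('k, 'b) module \<Rightarrow> ('a \<Rightarrow> 'b) set" where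
  "alg_hom A B =
     {h \<in> Ring.ring_hom A B. \<forall>s. \<forall>x\<in>carrier A. h (s \<odot>\<^bsub>A\<^esub> x) = s \<odot>\<^bsub>B\<^esub> h x}"

definition alg_aut :: "('k, 'a) module \<Rightarrow> ('a \<Rightarrow> 'a) set" where
  "alg_aut A = {h \<in> alg_hom A A. bij_betw h (carrier A) (carrier A)}"

definition mat_algebra :: "nat \<Rightarrow> ('k::field, 'k mat) module" where
  "mat_algebra n = ring_mat TYPE('k) n (module.fields (\<cdot>\<^sub>m))"

text \<open>The quotient of an algebra by a two-sided ideal; the scalar multiplication follows the
  pattern of \<^const>\<open>rcoset_mult\<close>, which \<open>Quot\<close> uses for the product.\<close>

definition quot_algebra :: "('k, 'a) module \<Rightarrow> 'a set \<Rightarrow> ('k, 'a set) module" where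
  "quot_algebra A I =
     ring.extend (A Quot I) (module.fields (\<lambda>s X. \<Union>x\<in>X. I +>\<^bsub>A\<^esub> (s \<odot>\<^bsub>A\<^esub> x)))"


section \<open>Left modules over a possibly non-commutative algebra\<close>

text \<open>The locale \<^locale>\<open>module\<close> without the commutativity of the ring.\<close>

locale left_module = R?: ring R + M?: abelian_group M
  for R :: "('s, 'c) ring_scheme" and M :: "('s, 'v) module" (structure) +
  assumes smult_closed: "r \<in> carrier R \<Longrightarrow> x \<in> carrier M \<Longrightarrow> r \<odot>\<^bsub>M\<^esub> x \<in> carrier M"
    and smult_l_distr: "r \<in> carrier R \<Longrightarrow> s \<in> carrier R \<Longrightarrow> x \<in> carrier M \<Longrightarrow>
      (r \<oplus>\<^bsub>R\<^esub> s) \<odot>\<^bsub>M\<^esub> x = r \<odot>\<^bsub>M\<^esub> x \<oplus>\<^bsub>M\<^esub> s \<odot>\<^bsub>M\<^esub> x"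
    and smult_r_distr: "r \<in> carrier R \<Longrightarrow> x \<in> carrier M \<Longrightarrow> y \<in> carrier M \<Longrightarrow>
      r \<odot>\<^bsub>M\<^esub> (x \<oplus>\<^bsub>M\<^esub> y) = r \<odot>\<^bsub>M\<^esub> x \<oplus>\<^bsub>M\<^esub> r \<odot>\<^bsub>M\<^esub> y"
    and smult_assoc1: "r \<in> carrier R \<Longrightarrow> s \<in> carrier R \<Longrightarrow> x \<in> carrier M \<Longrightarrow>
      (r \<otimes>\<^bsub>R\<^esub> s) \<odot>\<^bsub>M\<^esub> x = r \<odot>\<^bsub>M\<^esub> (s \<odot>\<^bsub>M\<^esub> x)"
    and smult_one: "x \<in> carrier M \<Longrightarrow> \<one>\<^bsub>R\<^esub> \<odot>\<^bsub>M\<^esub> x = x"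

text \<open>\<open>Module.submodule\<close> is the submodule notion of HOL-Algebra; the unqualified name would
  refer to another one, for commutative rings only.\<close>

definition simple_left_module :: "('s, 'c) ring_scheme \<Rightarrow> ('s, 'v) module \<Rightarrow> bool" where
  "simple_left_module R M \<longleftrightarrow> left_module R M \<and> carrier M \<noteq> {\<zero>\<^bsub>M\<^esub>} \<and>
     (\<forall>N. Module.submodule N R M \<longrightarrow> N = {\<zero>\<^bsub>M\<^esub>} \<or> N = carrier M)"

definition left_module_iso :: "('s, 'c) ring_scheme \<Rightarrow> ('s, 'v) module \<Rightarrow> ('s, 'w) module \<Rightarrow> bool" where
  "left_module_iso R M N \<longleftrightarrow> (\<exists>f \<in> LinearCombinations.module_hom R M N. bij_betw f (carrier M) (carrier N))"

definition pullback :: "('r \<Rightarrow> 's) \<Rightarrow> ('s, 'v) module \<Rightarrow> ('r, 'v) module" where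
  "pullback \<psi> M = ring.extend (ring.truncate M) (module.fields (\<lambda>r m. \<psi> r \<odot>\<^bsub>M\<^esub> m))"

text \<open>A left module over a \<open>k\<close>-algebra is a \<open>k\<close>-vector space through \<open>s \<mapsto> s \<cdot> 1\<close>. The conjunct
  \<open>fin_dim\<close> is needed because \<open>dim\<close> is a \<open>LEAST\<close> over a possibly empty set.\<close>

definition left_module_of_dim :: "('k::field, 'a) module \<Rightarrow> ('a, 'v) module \<Rightarrow> nat \<Rightarrow> bool" where
  "left_module_of_dim A M n \<longleftrightarrow>
     (let U = pullback (\<lambda>s. s \<odot>\<^bsub>A\<^esub> \<one>\<^bsub>A\<^esub>) M in
        left_module A M \<and> vectorspace (class_ring :: 'k ring) U \<and>
        vectorspace.fin_dim (class_ring :: 'k ring) U \<and>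
        vectorspace.dim (class_ring :: 'k ring) U = n)"

text \<open>The module of column vectors with structure map \<open>\<rho>\<close> into \<open>n \<times> n\<close> matrices.\<close>

definition rep_module :: "nat \<Rightarrow> ('a \<Rightarrow> 'k::field mat) \<Rightarrow> ('a, 'k vec) module" where
  "rep_module n \<rho> =
     ring.extend (ring.truncate (module_vec TYPE('k) n)) (module.fields (\<lambda>r v. \<rho> r *\<^sub>v v))"


section \<open>The free algebra\<close>

datatype 'g free_monoid = Word (letters: "'g list")

instantiation free_monoid :: (type) monoid_add
begin
definition "0 = Word []"
definition "u + v = Word (letters u @ letters v)"
instance by standard (auto simp: zero_free_monoid_def plus_free_monoid_def)
end

text \<open>The multiplication of \<^typ>\<open>'g free_monoid \<Rightarrow>\<^sub>0 'k\<close> is the convolution product, so this type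
  is the monoid algebra of the free monoid, i.e. the free algebra on \<^typ>\<open>'g\<close>.\<close>

definition free_algebra :: "('k::field, 'g free_monoid \<Rightarrow>\<^sub>0 'k) module" where
  "free_algebra = \<lparr>carrier = UNIV, mult = (*), one = 1, zero = 0, add = (+),
     smult = (\<lambda>s p. Poly_Mapping.single 0 s * p)\<rparr>"

definition free_gen :: "'g \<Rightarrow> ('g free_monoid \<Rightarrow>\<^sub>0 'k::field)" where
  "free_gen g = Poly_Mapping.single (Word [g]) 1"


section \<open>The 4-dimensional Sklyanin algebra\<close>

datatype gen = X0 | X1 | X2 | X3

definition sklyanin_rels :: "'k::field \<Rightarrow> 'k \<Rightarrow> 'k \<Rightarrow> (gen free_monoid \<Rightarrow>\<^sub>0 'k) set" where
  "sklyanin_rels \<alpha>\<^sub>1 \<alpha>\<^sub>2 \<alpha>\<^sub>3 =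
     (let x = free_gen in
      \<Union>(\<alpha>, i, j, k) \<in> {(\<alpha>\<^sub>1, X1, X2, X3), (\<alpha>\<^sub>2, X2, X3, X1), (\<alpha>\<^sub>3, X3, X1, X2)}.
        {x X0 * x i - x i * x X0 - Poly_Mapping.single 0 \<alpha> * (x j * x k + x k * x j),
         x X0 * x i + x i * x X0 - (x j * x k - x k * x j)})"

definition sklyanin_ideal :: "'k::field \<Rightarrow> 'k \<Rightarrow> 'k \<Rightarrow> (gen free_monoid \<Rightarrow>\<^sub>0 'k) set" where
  "sklyanin_ideal \<alpha>\<^sub>1 \<alpha>\<^sub>2 \<alpha>\<^sub>3 = genideal free_algebra (sklyanin_rels \<alpha>\<^sub>1 \<alpha>\<^sub>2 \<alpha>\<^sub>3)"

definition sklyanin_algebra ::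
    "'k::field \<Rightarrow> 'k \<Rightarrow> 'k \<Rightarrow> ('k, (gen free_monoid \<Rightarrow>\<^sub>0 'k) set) module" where
  "sklyanin_algebra \<alpha>\<^sub>1 \<alpha>\<^sub>2 \<alpha>\<^sub>3 = quot_algebra free_algebra (sklyanin_ideal \<alpha>\<^sub>1 \<alpha>\<^sub>2 \<alpha>\<^sub>3)"

definition sklyanin_gen ::
    "'k::field \<Rightarrow> 'k \<Rightarrow> 'k \<Rightarrow> gen \<Rightarrow> (gen free_monoid \<Rightarrow>\<^sub>0 'k) set" where
  "sklyanin_gen \<alpha>\<^sub>1 \<alpha>\<^sub>2 \<alpha>\<^sub>3 g = sklyanin_ideal \<alpha>\<^sub>1 \<alpha>\<^sub>2 \<alpha>\<^sub>3 +>\<^bsub>free_algebra\<^esub> free_gen g"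

definition q\<^sub>1 :: "'k::field \<Rightarrow> 'k mat" where
  "q\<^sub>1 \<iota> = mat_of_rows_list 2 [[\<iota>, 0], [0, - \<iota>]]"

definition q\<^sub>2 :: "'k::field \<Rightarrow> 'k mat" where
  "q\<^sub>2 \<iota> = mat_of_rows_list 2 [[0, \<iota>], [\<iota>, 0]]"

definition q\<^sub>3 :: "'k::field mat" where
  "q\<^sub>3 = mat_of_rows_list 2 [[0, - 1], [1, 0]]"

definition gen_images :: "(gen \<Rightarrow> 'x) \<Rightarrow> ('x \<Rightarrow> 'y) \<Rightarrow> 'y \<times> 'y \<times> 'y \<times> 'y \<Rightarrow> bool" where
  "gen_images x h ys \<longleftrightarrow> (h (x X0), h (x X1), h (x X2), h (x X3)) = ys"

text \<open>The values \<open>\<rho>\<^sub>j(x\<^sub>0), \<dots>, \<rho>\<^sub>j(x\<^sub>3)\<close> (scalars being scalar matrices); indices \<open>j > 3\<close> are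
  meaningless and never used.\<close>

fun rho_values :: "'k::field \<Rightarrow> 'k \<Rightarrow> 'k \<Rightarrow> 'k \<Rightarrow> nat \<Rightarrow> 'k mat \<times> 'k mat \<times> 'k mat \<times> 'k mat" where
  "rho_values a b c \<iota> 0 = (1\<^sub>m 2, q\<^sub>1 \<iota>, q\<^sub>2 \<iota>, q\<^sub>3)"
| "rho_values a b c \<iota> (Suc 0) =
     ((b * c) \<cdot>\<^sub>m q\<^sub>1 \<iota>, (- \<iota>) \<cdot>\<^sub>m 1\<^sub>m 2, (- \<iota> * b) \<cdot>\<^sub>m q\<^sub>3, (- c) \<cdot>\<^sub>m q\<^sub>2 \<iota>)"
| "rho_values a b c \<iota> (Suc (Suc 0)) =
     ((a * c) \<cdot>\<^sub>m q\<^sub>2 \<iota>, (- a) \<cdot>\<^sub>m q\<^sub>3, (- \<iota>) \<cdot>\<^sub>m 1\<^sub>m 2, (- \<iota> * c) \<cdot>\<^sub>m q\<^sub>1 \<iota>)"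
| "rho_values a b c \<iota> (Suc (Suc (Suc _))) =
     ((a * b) \<cdot>\<^sub>m q\<^sub>3, (- \<iota> * a) \<cdot>\<^sub>m q\<^sub>2 \<iota>, (- b) \<cdot>\<^sub>m q\<^sub>1 \<iota>, (- \<iota>) \<cdot>\<^sub>m 1\<^sub>m 2)"

text \<open>The values of \<open>\<phi>\<^sub>1, \<phi>\<^sub>2, \<phi>\<^sub>3\<close>; other indices are never used.\<close>

fun phi_values :: "('k::field, 's) module \<Rightarrow> (gen \<Rightarrow> 's) \<Rightarrow> 'k \<Rightarrow> 'k \<Rightarrow> 'k \<Rightarrow> 'k \<Rightarrow> nat \<Rightarrow>
    's \<times> 's \<times> 's \<times> 's" where
  "phi_values S x a b c \<iota> 0 = undefined"
| "phi_values S x a b c \<iota> (Suc 0) =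
     ((b * c) \<odot>\<^bsub>S\<^esub> x X1, (- \<iota>) \<odot>\<^bsub>S\<^esub> x X0, (- \<iota> * b) \<odot>\<^bsub>S\<^esub> x X3, (- c) \<odot>\<^bsub>S\<^esub> x X2)"
| "phi_values S x a b c \<iota> (Suc (Suc 0)) =
     ((a * c) \<odot>\<^bsub>S\<^esub> x X2, (- a) \<odot>\<^bsub>S\<^esub> x X3, (- \<iota>) \<odot>\<^bsub>S\<^esub> x X0, (- \<iota> * c) \<odot>\<^bsub>S\<^esub> x X1)"
| "phi_values S x a b c \<iota> (Suc (Suc (Suc _))) =
     ((a * b) \<odot>\<^bsub>S\<^esub> x X3, (- \<iota> * a) \<odot>\<^bsub>S\<^esub> x X2, (- b) \<odot>\<^bsub>S\<^esub> x X1, (- \<iota>) \<odot>\<^bsub>S\<^esub> x X0)"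


section \<open>Existence of the automorphisms\<close>

text \<open>The \<open>\<phi>\<^sub>j\<close> enter the theorem only through their values on the generators. The aim of this
  section is \<open>sklyanin_phi_exists\<close>, which shows that automorphisms with these values exist.
  They are unique by \<open>sklyanin_hom_unique\<close>.\<close>


lemma free_algebra_induct:
  fixes p :: "'g free_monoid \<Rightarrow>\<^sub>0 'k::field"
  assumes "\<And>w s. P (Poly_Mapping.single w s)" "\<And>p q. P p \<Longrightarrow> P q \<Longrightarrow> P (p + q)"
  shows "P p"
proof (induction p rule: update_induct)
  case const
  show ?case using assms(1)[of 0 0] by simp
next
  case (update p w s)
  then have "poly_mapping.lookup p w = 0" by (simp add: in_keys_iff)
  then have "Poly_Mapping.update w s p = Poly_Mapping.single w s + p"
    by (intro poly_mapping_eqI) (auto simp: lookup_update lookup_add lookup_single when_def)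
  then show ?case using assms update by metis
qed

lemma letters_0 [simp]: "letters 0 = []"
  by (simp add: zero_free_monoid_def)

lemma single_0_commute:
  fixes p :: "'g free_monoid \<Rightarrow>\<^sub>0 'k::field"
  shows "p * Poly_Mapping.single 0 s = Poly_Mapping.single 0 s * p"
  by (induction p rule: free_algebra_induct) (auto simp: mult_single algebra_simps)

lemma free_algebra_simps [simp]:
  "carrier free_algebra = UNIV" "mult free_algebra = (*)" "one free_algebra = 1"
  "zero free_algebra = 0" "add free_algebra = (+)"
  "module.smult free_algebra s p = Poly_Mapping.single 0 s * p"
  by (simp_all add: free_algebra_def)

lemma ring_free: "ring (free_algebra :: ('k::field, 'g free_monoid \<Rightarrow>\<^sub>0 'k) module)"
proof (intro ringI abelian_groupI monoidI, goal_cases)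
  case (6 x)
  show ?case by (rule bexI[of _ "- x"]) simp_all
qed (simp_all add: add.commute add.left_commute mult.assoc distrib_left distrib_right)

lemma k_algebra_free: "k_algebra (free_algebra :: ('k::field, 'g free_monoid \<Rightarrow>\<^sub>0 'k) module)"
proof -
  interpret ring "free_algebra :: ('k, 'g free_monoid \<Rightarrow>\<^sub>0 'k) module" by (rule ring_free)
  show ?thesis
  proof (unfold_locales, goal_cases)
    case (7 x y s)
    then show ?case by (simp add: mult.assoc[symmetric] single_0_commute)
  qed (auto simp: distrib_left distrib_right single_add mult_single mult.assoc[symmetric])
qed


subsection \<open>Homomorphisms out of the free algebra\<close>

context k_algebra
begin

primrec word_value :: "('g \<Rightarrow> 'a) \<Rightarrow> 'g list \<Rightarrow> 'a" where
  "word_value f [] = \<one>"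
| "word_value f (g # gs) = f g \<otimes> word_value f gs"

definition free_lift :: "('g \<Rightarrow> 'a) \<Rightarrow> ('g free_monoid \<Rightarrow>\<^sub>0 'k) \<Rightarrow> 'a" where
  "free_lift f p = (\<Oplus>w\<in>Poly_Mapping.keys p. poly_mapping.lookup p w \<odot> word_value f (letters w))"

lemma smult_zero: "x \<in> carrier A \<Longrightarrow> 0 \<odot> x = \<zero>"
  using smult_l_distr[of x 0 0] smult_closed[of x 0] by simp

lemma smult_left_commute: "x \<in> carrier A \<Longrightarrow> s \<odot> (t \<odot> x) = t \<odot> (s \<odot> x)"
  by (metis smult_assoc1 mult.commute)

lemma word_value_closed: "range f \<subseteq> carrier A \<Longrightarrow> word_value f gs \<in> carrier A"
  by (induction gs) auto

lemma word_value_append: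
  "range f \<subseteq> carrier A \<Longrightarrow> word_value f (gs @ hs) = word_value f gs \<otimes> word_value f hs"
  by (induction gs) (auto simp: word_value_closed m_assoc image_subset_iff)

lemma free_lift_superset:
  assumes "range f \<subseteq> carrier A" "finite W" "Poly_Mapping.keys p \<subseteq> W"
  shows "free_lift f p = (\<Oplus>w\<in>W. poly_mapping.lookup p w \<odot> word_value f (letters w))"
  unfolding free_lift_def
  using assms
  by (intro add.finprod_mono_neutral_cong_left)
     (auto simp: in_keys_iff smult_zero smult_closed word_value_closed)

lemma free_lift_closed: "range f \<subseteq> carrier A \<Longrightarrow> free_lift f p \<in> carrier A"
  unfolding free_lift_def by (intro finsum_closed) (auto simp: smult_closed word_value_closed)

lemma free_lift_add:
  assumes "range f \<subseteq> carrier A"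
  shows "free_lift f (p + q) = free_lift f p \<oplus> free_lift f q"
proof -
  have "Poly_Mapping.keys (p + q) \<subseteq> Poly_Mapping.keys p \<union> Poly_Mapping.keys q" by (rule keys_add)
  then show ?thesis
    using assms
    by (simp add: free_lift_superset[where W = "Poly_Mapping.keys p \<union> Poly_Mapping.keys q"] lookup_add smult_l_distr
        word_value_closed smult_closed finsum_addf Pi_def)
qed

lemma free_lift_single:
  assumes "range f \<subseteq> carrier A"
  shows "free_lift f (Poly_Mapping.single w s) = s \<odot> word_value f (letters w)"
proof -
  have "Poly_Mapping.keys (Poly_Mapping.single w s) \<subseteq> {w}" by simp
  then show ?thesis
    using assms
    by (simp add: free_lift_superset[where W = "{w}"] word_value_closed smult_closed)
qed

lemma free_lift_gen:
  assumes "range f \<subseteq> carrier A"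
  shows "free_lift f (free_gen g) = f g"
  using assms by (auto simp: free_gen_def free_lift_single smult_one image_subset_iff)

lemma free_lift_mult:
  assumes f: "range f \<subseteq> carrier A"
  shows "free_lift f (p * q) = free_lift f p \<otimes> free_lift f q"
proof (induction p rule: free_algebra_induct)
  case (1 w s)
  show ?case
  proof (induction q rule: free_algebra_induct)
    case (1 v t)
    show ?case using f
      by (simp add: mult_single free_lift_single plus_free_monoid_def word_value_append
          word_value_closed smult_closed smult_mult_l smult_mult_r smult_assoc1 smult_left_commute)
  next
    case (2 p q)
    then show ?case using f
      by (simp add: distrib_left free_lift_add r_distr free_lift_closed)
  qed
next
  case (2 p q)
  then show ?case using f
    by (simp add: distrib_right free_lift_add l_distr free_lift_closed)
qed

lemma free_lift_hom:
  assumes f: "range f \<subseteq> carrier A"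
  shows "free_lift f \<in> alg_hom free_algebra A"
proof -
  have one: "free_lift f 1 = \<one>"
    using free_lift_single[OF f, of 0 1] by (simp add: smult_one)
  have "free_lift f (Poly_Mapping.single 0 s * p) = s \<odot> free_lift f p" for s p
    using f one
    by (simp add: free_lift_mult free_lift_single smult_mult_l
        free_lift_closed)
  then show ?thesis
    using f one unfolding alg_hom_def
    by (auto intro!: ring_hom_memI simp: free_lift_closed free_lift_mult free_lift_add)
qed

end

subsection \<open>Homomorphisms out of a quotient\<close>

lemma alg_hom_ring_hom_ring:
  assumes "k_algebra A" "k_algebra B" "h \<in> alg_hom A B"
  shows "ring_hom_ring A B h"
  using assms by (auto simp: alg_hom_def k_algebra_def intro: ring_hom_ringI2)

lemma quot_algebra_simps [simp]:
  "carrier (quot_algebra A I) = carrier (A Quot I)" "mult (quot_algebra A I) = mult (A Quot I)"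
  "one (quot_algebra A I) = one (A Quot I)" "zero (quot_algebra A I) = zero (A Quot I)"
  "add (quot_algebra A I) = add (A Quot I)"
  "module.smult (quot_algebra A I) s X = (\<Union>x\<in>X. I +>\<^bsub>A\<^esub> (s \<odot>\<^bsub>A\<^esub> x))"
  by (simp_all add: quot_algebra_def ring.extend_def module.fields_def)

lemma ring_record_cong:
  assumes "ring R" "carrier S = carrier R" "mult S = mult R" "one S = one R" "zero S = zero R"
    "add S = add R"
  shows "ring S"
proof -
  interpret ring R by fact
  note eqs = assms(2-)
  show ?thesis
  proof (intro ringI abelian_groupI monoidI, unfold eqs, goal_cases)
    case (6 x)
    then show ?case using l_neg a_inv_closed by blast
  qed (simp_all add: m_assoc a_ac l_distr r_distr)
qed

context k_algebra
begin

lemma ideal_smult: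
  assumes "ideal I A" "x \<in> I"
  shows "s \<odot> x \<in> I"
proof -
  interpret I: ideal I A by fact
  have "(s \<odot> \<one>) \<otimes> x \<in> I" using assms by (intro I.I_l_closed smult_closed) auto
  then show ?thesis using assms I.a_subset by (auto simp: smult_mult_l subset_iff)
qed

lemma quot_smult:
  assumes "ideal I A" "x \<in> carrier A"
  shows "module.smult (quot_algebra A I) s (I +> x) = I +> (s \<odot> x)"
proof -
  interpret I: ideal I A by fact
  have "I +> (s \<odot> y) = I +> (s \<odot> x)" if y: "y \<in> I +> x" for y
  proof -
    obtain i where i: "i \<in> I" "y = i \<oplus> x" using y by (auto simp: a_r_coset_def')
    then have "s \<odot> y = s \<odot> i \<oplus> s \<odot> x"
      using assms I.a_Hcarr by (simp add: smult_r_distr)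
    then have "s \<odot> y \<in> I +> (s \<odot> x)"
      using ideal_smult[OF assms(1) i(1)] by (auto simp: a_r_coset_def')
    then show ?thesis
      using a_repr_independence assms smult_closed I.a_subgroup by metis
  qed
  then have "(\<Union>y\<in>I +> x. I +> (s \<odot> y)) = (\<Union>y\<in>I +> x. I +> (s \<odot> x))"
    by (rule SUP_cong[OF refl])
  moreover have "x \<in> I +> x" using assms by (intro I.a_rcos_self)
  ultimately show ?thesis by (simp only: quot_algebra_simps) blast
qed

lemma quot_k_algebra:
  assumes "ideal I A"
  shows "k_algebra (quot_algebra A I)"
    and "(+>) I \<in> alg_hom A (quot_algebra A I)"
proof -
  interpret I: ideal I A by fact
  interpret Q: ring "quot_algebra A I"
    by (rule ring_record_cong[OF I.quotient_is_ring]) auto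
  have car: "carrier (quot_algebra A I) = (\<lambda>x. I +> x) ` carrier A"
    by (auto simp: FactRing_def A_RCOSETS_def')
  have h: "(+>) I \<in> Ring.ring_hom A (quot_algebra A I)"
    using I.rcos_ring_hom by (auto simp: Ring.ring_hom_def)
  note qs = quot_smult[OF assms]
  note hs = ring_hom_mult[OF h, symmetric] ring_hom_add[OF h, symmetric]
  show "(+>) I \<in> alg_hom A (quot_algebra A I)"
    using h by (simp add: alg_hom_def quot_smult[OF assms] del: quot_algebra_simps)
  show "k_algebra (quot_algebra A I)"
  proof (unfold_locales, goal_cases)
    case (1 X s)
    then show ?case using car smult_closed by (auto simp: qs simp del: quot_algebra_simps)
  next
    case (2 X s t)
    then show ?case using car
      by (auto simp: qs hs smult_closed smult_l_distr simp del: quot_algebra_simps)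
  next
    case (3 X Y s)
    then show ?case using car
      by (auto simp: qs hs smult_closed smult_r_distr simp del: quot_algebra_simps)
  next
    case (4 X s t)
    then show ?case using car
      by (auto simp: qs smult_closed smult_assoc1 simp del: quot_algebra_simps)
  next
    case (5 X)
    then show ?case using car by (auto simp: qs smult_one simp del: quot_algebra_simps)
  next
    case (6 X Y s)
    then show ?case using car
      by (auto simp: qs hs smult_closed smult_mult_l simp del: quot_algebra_simps)
  next
    case (7 X Y s)
    then show ?case using car
      by (auto simp: qs hs smult_closed smult_mult_r simp del: quot_algebra_simps)
  qed
qed

definition quot_lift :: "'a set \<Rightarrow> ('a \<Rightarrow> 'b) \<Rightarrow> 'a set \<Rightarrow> 'b" where
  "quot_lift I h = restrict (\<lambda>X. the_elem (h ` X)) (carrier (A Quot I))"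

lemma quot_lift:
  assumes "ideal I A" "k_algebra B" "h \<in> alg_hom A B" "\<And>x. x \<in> I \<Longrightarrow> h x = \<zero>\<^bsub>B\<^esub>"
  shows "x \<in> carrier A \<Longrightarrow> quot_lift I h (I +> x) = h x"
    and "quot_lift I h \<in> alg_hom (quot_algebra A I) B"
proof -
  interpret I: ideal I A by fact
  interpret B: k_algebra B by fact
  interpret h: ring_hom_ring A B h
    by (rule alg_hom_ring_hom_ring[OF _ assms(2,3)]) unfold_locales
  have car: "carrier (A Quot I) = (\<lambda>x. I +> x) ` carrier A"
    by (auto simp: FactRing_def A_RCOSETS_def')
  have sm: "h (s \<odot> x) = s \<odot>\<^bsub>B\<^esub> h x" if "x \<in> carrier A" for s x
    using assms(3) that by (simp add: alg_hom_def)
  have img: "h ` (I +> x) = {h x}" if "x \<in> carrier A" for x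
  proof -
    have "h y = h x" if "y \<in> I +> x" for y
      using that assms(4) I.a_Hcarr \<open>x \<in> carrier A\<close> by (auto simp: a_r_coset_def')
    moreover have "x \<in> I +> x" by (rule I.a_rcos_self[OF that])
    ultimately show ?thesis by blast
  qed
  show val: "quot_lift I h (I +> x) = h x" if "x \<in> carrier A" for x
    using that by (simp add: quot_lift_def car img)
  have r: "(+>) I \<in> Ring.ring_hom A (quot_algebra A I)"
    using quot_k_algebra(2)[OF assms(1)] by (simp add: alg_hom_def)
  have car': "carrier (quot_algebra A I) = (\<lambda>x. I +> x) ` carrier A"
    using car by simp
  note rs = ring_hom_mult[OF r, symmetric] ring_hom_add[OF r, symmetric] ring_hom_one[OF r, symmetric]
  have "quot_lift I h \<in> Ring.ring_hom (quot_algebra A I) B"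
  proof (rule ring_hom_memI)
    fix X Y assume "X \<in> carrier (quot_algebra A I)" "Y \<in> carrier (quot_algebra A I)"
    then obtain x y where "X = I +> x" "Y = I +> y" "x \<in> carrier A" "y \<in> carrier A"
      unfolding car' by auto
    then show "quot_lift I h X \<in> carrier B"
      and "quot_lift I h (X \<otimes>\<^bsub>quot_algebra A I\<^esub> Y) = quot_lift I h X \<otimes>\<^bsub>B\<^esub> quot_lift I h Y"
      and "quot_lift I h (X \<oplus>\<^bsub>quot_algebra A I\<^esub> Y) = quot_lift I h X \<oplus>\<^bsub>B\<^esub> quot_lift I h Y"
      by (simp_all add: rs val del: quot_algebra_simps)
  next
    show "quot_lift I h \<one>\<^bsub>quot_algebra A I\<^esub> = \<one>\<^bsub>B\<^esub>"
      by (simp add: rs(3) val del: quot_algebra_simps)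
  qed
  then show "quot_lift I h \<in> alg_hom (quot_algebra A I) B"
    unfolding alg_hom_def
    by (auto simp: car' val sm quot_smult[OF assms(1)] smult_closed simp del: quot_algebra_simps)
qed

end


subsection \<open>Homomorphisms out of the Sklyanin algebra\<close>

lemma ideal_sklyanin: "ideal (sklyanin_ideal \<alpha>\<^sub>1 \<alpha>\<^sub>2 \<alpha>\<^sub>3) free_algebra"
  unfolding sklyanin_ideal_def by (rule ring.genideal_ideal[OF ring_free]) simp

lemma k_algebra_sklyanin: "k_algebra (sklyanin_algebra \<alpha>\<^sub>1 \<alpha>\<^sub>2 \<alpha>\<^sub>3)"
  unfolding sklyanin_algebra_def
  by (rule k_algebra.quot_k_algebra(1)[OF k_algebra_free ideal_sklyanin])

lemma sklyanin_proj_hom: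
  "(+>\<^bsub>free_algebra\<^esub>) (sklyanin_ideal \<alpha>\<^sub>1 \<alpha>\<^sub>2 \<alpha>\<^sub>3) \<in> alg_hom free_algebra (sklyanin_algebra \<alpha>\<^sub>1 \<alpha>\<^sub>2 \<alpha>\<^sub>3)"
  unfolding sklyanin_algebra_def
  by (rule k_algebra.quot_k_algebra(2)[OF k_algebra_free ideal_sklyanin])

lemma sklyanin_hom_exists:
  fixes B :: "('k::field, 'b) module"
  assumes "k_algebra B" "h \<in> alg_hom free_algebra B"
    "\<And>r. r \<in> sklyanin_rels \<alpha>\<^sub>1 \<alpha>\<^sub>2 \<alpha>\<^sub>3 \<Longrightarrow> h r = \<zero>\<^bsub>B\<^esub>"
  shows "\<exists>\<rho> \<in> alg_hom (sklyanin_algebra \<alpha>\<^sub>1 \<alpha>\<^sub>2 \<alpha>\<^sub>3) B.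
    \<forall>g. \<rho> (sklyanin_gen \<alpha>\<^sub>1 \<alpha>\<^sub>2 \<alpha>\<^sub>3 g) = h (free_gen g)"
proof -
  interpret h: ring_hom_ring free_algebra B h
    by (rule alg_hom_ring_hom_ring[OF k_algebra_free assms(1,2)])
  have "sklyanin_rels \<alpha>\<^sub>1 \<alpha>\<^sub>2 \<alpha>\<^sub>3 \<subseteq> a_kernel free_algebra B h"
    unfolding a_kernel_def' free_algebra_simps using assms(3) by blast
  then have "sklyanin_ideal \<alpha>\<^sub>1 \<alpha>\<^sub>2 \<alpha>\<^sub>3 \<subseteq> a_kernel free_algebra B h"
    unfolding sklyanin_ideal_def by (rule ring.genideal_minimal[OF ring_free h.kernel_is_ideal])
  then have z: "h p = \<zero>\<^bsub>B\<^esub>" if "p \<in> sklyanin_ideal \<alpha>\<^sub>1 \<alpha>\<^sub>2 \<alpha>\<^sub>3" for p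
    using that unfolding a_kernel_def' by blast
  note q = k_algebra.quot_lift[OF k_algebra_free ideal_sklyanin[of \<alpha>\<^sub>1 \<alpha>\<^sub>2 \<alpha>\<^sub>3] assms(1,2) z]
  show ?thesis
    unfolding sklyanin_algebra_def sklyanin_gen_def by (intro bexI[OF _ q(2)] allI q(1)) simp_all
qed

lemma free_hom_unique:
  fixes h h' :: "('g free_monoid \<Rightarrow>\<^sub>0 'k::field) \<Rightarrow> 'b"
  assumes "k_algebra B" "h \<in> alg_hom free_algebra B" "h' \<in> alg_hom free_algebra B"
    "\<And>g. h (free_gen g) = h' (free_gen g)"
  shows "h p = h' p"
proof -
  interpret h: ring_hom_ring free_algebra B h
    by (rule alg_hom_ring_hom_ring[OF k_algebra_free assms(1,2)])
  interpret h': ring_hom_ring free_algebra B h'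
    by (rule alg_hom_ring_hom_ring[OF k_algebra_free assms(1,3)])
  have word: "h (Poly_Mapping.single (Word gs) 1) = h' (Poly_Mapping.single (Word gs) 1)" for gs
  proof (induction gs)
    case Nil
    then show ?case using h.hom_one h'.hom_one by (simp add: zero_free_monoid_def[symmetric])
  next
    case (Cons g gs)
    have "Poly_Mapping.single (Word (g # gs)) 1 =
        free_gen g * (Poly_Mapping.single (Word gs) 1 :: 'g free_monoid \<Rightarrow>\<^sub>0 'k)"
      by (simp add: free_gen_def mult_single plus_free_monoid_def)
    then show ?case using Cons assms(4) h.hom_mult h'.hom_mult by simp
  qed
  show ?thesis
  proof (induction p rule: free_algebra_induct)
    case (1 w s)
    obtain gs where w: "w = Word gs" by (cases w)
    have eq: "Poly_Mapping.single w s = module.smult free_algebra s (Poly_Mapping.single w 1)"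
      by (simp add: mult_single)
    show ?case
      unfolding eq using assms(2,3) word[of gs] by (simp add: alg_hom_def w del: free_algebra_simps(6))
  next
    case (2 p q)
    then show ?case using h.hom_add h'.hom_add by simp
  qed
qed

lemma alg_hom_comp: "h \<in> alg_hom A B \<Longrightarrow> h' \<in> alg_hom B C \<Longrightarrow> h' \<circ> h \<in> alg_hom A C"
  by (auto simp: alg_hom_def Ring.ring_hom_def Pi_def)

lemma sklyanin_carrier:
  "carrier (sklyanin_algebra \<alpha>\<^sub>1 \<alpha>\<^sub>2 \<alpha>\<^sub>3) =
    range ((+>\<^bsub>free_algebra\<^esub>) (sklyanin_ideal \<alpha>\<^sub>1 \<alpha>\<^sub>2 \<alpha>\<^sub>3))"
  by (auto simp: sklyanin_algebra_def FactRing_def A_RCOSETS_def')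

lemma sklyanin_hom_unique:
  assumes "k_algebra B" "\<rho> \<in> alg_hom (sklyanin_algebra \<alpha>\<^sub>1 \<alpha>\<^sub>2 \<alpha>\<^sub>3) B"
    "\<rho>' \<in> alg_hom (sklyanin_algebra \<alpha>\<^sub>1 \<alpha>\<^sub>2 \<alpha>\<^sub>3) B"
    "\<And>g. \<rho> (sklyanin_gen \<alpha>\<^sub>1 \<alpha>\<^sub>2 \<alpha>\<^sub>3 g) = \<rho>' (sklyanin_gen \<alpha>\<^sub>1 \<alpha>\<^sub>2 \<alpha>\<^sub>3 g)"
    "X \<in> carrier (sklyanin_algebra \<alpha>\<^sub>1 \<alpha>\<^sub>2 \<alpha>\<^sub>3)"
  shows "\<rho> X = \<rho>' X"
proof -
  obtain p where X: "X = sklyanin_ideal \<alpha>\<^sub>1 \<alpha>\<^sub>2 \<alpha>\<^sub>3 +>\<^bsub>free_algebra\<^esub> p"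
    using assms(5) by (auto simp: sklyanin_carrier)
  show ?thesis
    using free_hom_unique[OF assms(1) alg_hom_comp[OF sklyanin_proj_hom assms(2)]
        alg_hom_comp[OF sklyanin_proj_hom assms(3)], of p] assms(4)
    by (simp add: X sklyanin_gen_def)
qed

subsection \<open>The automorphisms\<close>

lemma sklyanin_zero_iff:
  "X = \<zero>\<^bsub>sklyanin_algebra \<alpha>\<^sub>1 \<alpha>\<^sub>2 \<alpha>\<^sub>3\<^esub> \<longleftrightarrow> X = sklyanin_ideal \<alpha>\<^sub>1 \<alpha>\<^sub>2 \<alpha>\<^sub>3"
  by (simp add: sklyanin_algebra_def FactRing_def)

lemma sklyanin_proj_zero:
  assumes "p \<in> sklyanin_ideal \<alpha>\<^sub>1 \<alpha>\<^sub>2 \<alpha>\<^sub>3"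
  shows "sklyanin_ideal \<alpha>\<^sub>1 \<alpha>\<^sub>2 \<alpha>\<^sub>3 +>\<^bsub>free_algebra\<^esub> p = \<zero>\<^bsub>sklyanin_algebra \<alpha>\<^sub>1 \<alpha>\<^sub>2 \<alpha>\<^sub>3\<^esub>"
proof -
  interpret I: ideal "sklyanin_ideal \<alpha>\<^sub>1 \<alpha>\<^sub>2 \<alpha>\<^sub>3" free_algebra by (rule ideal_sklyanin)
  show ?thesis using I.a_rcos_const[OF assms] by (simp add: sklyanin_zero_iff)
qed

definition rel_comm where
  "rel_comm \<alpha> i j k = free_gen X0 * free_gen i - free_gen i * free_gen X0
     - Poly_Mapping.single 0 \<alpha> * (free_gen j * free_gen k + free_gen k * free_gen j)"

definition rel_anti where
  "rel_anti i j k = free_gen X0 * free_gen i + free_gen i * free_gen X0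
     - (free_gen j * free_gen k - free_gen k * free_gen j)"

text \<open>\<open>(i, j, k)\<close> is a cyclic permutation of \<open>(1, 2, 3)\<close>, with parameters \<open>\<alpha>\<^sub>i, \<alpha>\<^sub>j, \<alpha>\<^sub>k\<close>.\<close>

definition cyclic :: "'k \<Rightarrow> 'k \<Rightarrow> 'k \<Rightarrow> gen \<times> gen \<times> gen \<Rightarrow> 'k \<times> 'k \<times> 'k \<Rightarrow> bool" where
  "cyclic \<alpha>\<^sub>1 \<alpha>\<^sub>2 \<alpha>\<^sub>3 g \<alpha> \<longleftrightarrow> (g, \<alpha>) \<in> {((X1, X2, X3), (\<alpha>\<^sub>1, \<alpha>\<^sub>2, \<alpha>\<^sub>3)),
     ((X2, X3, X1), (\<alpha>\<^sub>2, \<alpha>\<^sub>3, \<alpha>\<^sub>1)), ((X3, X1, X2), (\<alpha>\<^sub>3, \<alpha>\<^sub>1, \<alpha>\<^sub>2))}"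

lemma sklyanin_rels_cyclic:
  assumes "cyclic \<alpha>\<^sub>1 \<alpha>\<^sub>2 \<alpha>\<^sub>3 (i, j, k) (\<alpha>, \<beta>, \<gamma>)"
  shows "sklyanin_rels \<alpha>\<^sub>1 \<alpha>\<^sub>2 \<alpha>\<^sub>3 = {rel_comm \<alpha> i j k, rel_anti i j k, rel_comm \<beta> j k i,
    rel_anti j k i, rel_comm \<gamma> k i j, rel_anti k i j}"
  using assms unfolding cyclic_def sklyanin_rels_def rel_comm_def rel_anti_def Let_def
  by auto

lemma cyclic_gens:
  assumes "cyclic \<alpha>\<^sub>1 \<alpha>\<^sub>2 \<alpha>\<^sub>3 (i, j, k) (\<alpha>, \<beta>, \<gamma>)"
  shows "distinct [X0, i, j, k]" "g = X0 \<or> g = i \<or> g = j \<or> g = k"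
  using assms by (cases g; auto simp: cyclic_def)+

definition scaled_perm :: "gen \<Rightarrow> gen \<Rightarrow> gen \<Rightarrow> 'k \<times> 'k \<times> 'k \<times> 'k \<Rightarrow> gen \<Rightarrow>
    (gen free_monoid \<Rightarrow>\<^sub>0 'k::field)" where
  "scaled_perm i j k s g = (case s of (s0, s1, s2, s3) \<Rightarrow>
     if g = X0 then Poly_Mapping.single (Word [i]) s0
     else if g = i then Poly_Mapping.single (Word [X0]) s1
     else if g = j then Poly_Mapping.single (Word [k]) s2
     else Poly_Mapping.single (Word [j]) s3)"

lemma free_end_simps:
  fixes h :: "('g free_monoid \<Rightarrow>\<^sub>0 'k::field) \<Rightarrow> ('g free_monoid \<Rightarrow>\<^sub>0 'k)"
  assumes "h \<in> alg_hom free_algebra free_algebra"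
  shows "h (p + q) = h p + h q" "h (p * q) = h p * h q" "h (p - q) = h p - h q"
    "h (Poly_Mapping.single 0 s) = Poly_Mapping.single 0 s"
proof -
  show a: "h (p + q) = h p + h q" for p q
    using assms by (auto simp: alg_hom_def Ring.ring_hom_def)
  show "h (p * q) = h p * h q"
    using assms by (auto simp: alg_hom_def Ring.ring_hom_def)
  have "h (Poly_Mapping.single 0 s * q) = Poly_Mapping.single 0 s * h q" for q
    using assms by (simp add: alg_hom_def)
  from this[of 1] show "h (Poly_Mapping.single 0 s) = Poly_Mapping.single 0 s"
    using assms by (simp add: alg_hom_def Ring.ring_hom_def)
  show "h (p - q) = h p - h q"
    using a[of "p - q" q] by (simp add: algebra_simps)
qed

lemma scaled_perm_rels:
  assumes cyc: "cyclic \<alpha>\<^sub>1 \<alpha>\<^sub>2 \<alpha>\<^sub>3 (i, j, k) (\<alpha>, \<beta>, \<gamma>)"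
    and s: "s2 * s3 = - (s0 * s1)" "s0 * s2 = - (\<beta> * (s1 * s3))" "s0 * s3 = \<gamma> * (s1 * s2)"
    and h: "h \<in> alg_hom free_algebra free_algebra"
      "\<And>g. h (free_gen g) = scaled_perm i j k (s0, s1, s2, s3) g"
    and r: "r \<in> sklyanin_rels \<alpha>\<^sub>1 \<alpha>\<^sub>2 \<alpha>\<^sub>3"
  shows "h r \<in> sklyanin_ideal \<alpha>\<^sub>1 \<alpha>\<^sub>2 \<alpha>\<^sub>3"
proof -
  have "\<exists>r' u. r' \<in> sklyanin_rels \<alpha>\<^sub>1 \<alpha>\<^sub>2 \<alpha>\<^sub>3 \<and> h r = Poly_Mapping.single 0 u * r'"
  proof -
    note d = cyclic_gens(1)[OF cyc]
    have f: "h (free_gen X0) = Poly_Mapping.single (Word [i]) s0"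
      "h (free_gen i) = Poly_Mapping.single (Word [X0]) s1"
      "h (free_gen j) = Poly_Mapping.single (Word [k]) s2"
      "h (free_gen k) = Poly_Mapping.single (Word [j]) s3"
      using d by (auto simp: h(2) scaled_perm_def)
    note push = rel_comm_def rel_anti_def free_end_simps[OF h(1)] f
    note simps = free_gen_def mult_single plus_free_monoid_def algebra_simps
    have "h (rel_comm \<alpha> i j k) = Poly_Mapping.single 0 (- (s0 * s1)) * rel_comm \<alpha> i j k"
      unfolding push using d s(1)
      by (simp add: simps single_uminus)
    moreover have "h (rel_anti i j k) = Poly_Mapping.single 0 (s0 * s1) * rel_anti i j k"
      unfolding push using d s(1)
      by (simp add: simps single_uminus)
    moreover have "h (rel_comm \<beta> j k i) = Poly_Mapping.single 0 (s0 * s2) * rel_anti j k i"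
      unfolding push using d s(2)
      by (simp add: simps single_uminus)
    moreover have "h (rel_anti j k i) = Poly_Mapping.single 0 (s1 * s3) * rel_comm \<beta> j k i"
      unfolding push using d s(2)
      by (simp add: simps single_uminus)
    moreover have "h (rel_comm \<gamma> k i j) = Poly_Mapping.single 0 (- (s0 * s3)) * rel_anti k i j"
      unfolding push using d s(3)
      by (simp add: simps single_uminus)
    moreover have "h (rel_anti k i j) = Poly_Mapping.single 0 (- (s1 * s2)) * rel_comm \<gamma> k i j"
      unfolding push using d s(3)
      by (simp add: simps single_uminus)
    ultimately show ?thesis using r unfolding sklyanin_rels_cyclic[OF cyc] by blast
  qed
  then obtain r' u where r': "r' \<in> sklyanin_rels \<alpha>\<^sub>1 \<alpha>\<^sub>2 \<alpha>\<^sub>3" "h r = Poly_Mapping.single 0 u * r'"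
    by blast
  have "r' \<in> sklyanin_ideal \<alpha>\<^sub>1 \<alpha>\<^sub>2 \<alpha>\<^sub>3"
    unfolding sklyanin_ideal_def
    by (rule subsetD[OF ring.genideal_self[OF ring_free] r'(1)]) simp
  then show ?thesis
    using k_algebra.ideal_smult[OF k_algebra_free ideal_sklyanin, of r' _ _ _ u] r'(2) by simp
qed

lemma scaled_perm_hom:
  assumes cyc: "cyclic \<alpha>\<^sub>1 \<alpha>\<^sub>2 \<alpha>\<^sub>3 (i, j, k) (\<alpha>, \<beta>, \<gamma>)"
    and s: "s2 * s3 = - (s0 * s1)" "s0 * s2 = - (\<beta> * (s1 * s3))" "s0 * s3 = \<gamma> * (s1 * s2)"
  defines "S \<equiv> sklyanin_algebra \<alpha>\<^sub>1 \<alpha>\<^sub>2 \<alpha>\<^sub>3" and "x \<equiv> sklyanin_gen \<alpha>\<^sub>1 \<alpha>\<^sub>2 \<alpha>\<^sub>3"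
  shows "\<exists>\<phi> \<in> alg_hom S S. \<phi> (x X0) = s0 \<odot>\<^bsub>S\<^esub> x i \<and> \<phi> (x i) = s1 \<odot>\<^bsub>S\<^esub> x X0 \<and>
    \<phi> (x j) = s2 \<odot>\<^bsub>S\<^esub> x k \<and> \<phi> (x k) = s3 \<odot>\<^bsub>S\<^esub> x j"
proof -
  let ?f = "scaled_perm i j k (s0, s1, s2, s3)"
  let ?h = "k_algebra.free_lift free_algebra ?f"
  let ?p = "(+>\<^bsub>free_algebra\<^esub>) (sklyanin_ideal \<alpha>\<^sub>1 \<alpha>\<^sub>2 \<alpha>\<^sub>3)"
  have h: "?h \<in> alg_hom free_algebra free_algebra"
    by (rule k_algebra.free_lift_hom[OF k_algebra_free]) simp
  have hg: "?h (free_gen g) = ?f g" for g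
    by (rule k_algebra.free_lift_gen[OF k_algebra_free]) simp
  have z: "(?p \<circ> ?h) r = \<zero>\<^bsub>S\<^esub>" if "r \<in> sklyanin_rels \<alpha>\<^sub>1 \<alpha>\<^sub>2 \<alpha>\<^sub>3" for r
    unfolding S_def o_def by (intro sklyanin_proj_zero scaled_perm_rels[OF cyc s h hg that])
  from sklyanin_hom_exists[of _ _ \<alpha>\<^sub>1 \<alpha>\<^sub>2 \<alpha>\<^sub>3, OF k_algebra_sklyanin alg_hom_comp[OF h sklyanin_proj_hom]
      z[unfolded S_def]]
  obtain \<phi> where \<phi>: "\<phi> \<in> alg_hom S S" "\<And>g. \<phi> (x g) = ?p (?f g)"
    unfolding S_def x_def by (auto simp: hg)
  have sm: "?p (Poly_Mapping.single (Word [g]) t) = t \<odot>\<^bsub>S\<^esub> x g" for g t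
  proof -
    have "Poly_Mapping.single (Word [g]) t = module.smult free_algebra t (free_gen g)"
      by (simp add: free_gen_def mult_single)
    then show ?thesis
      using sklyanin_proj_hom[of \<alpha>\<^sub>1 \<alpha>\<^sub>2 \<alpha>\<^sub>3]
      by (simp add: alg_hom_def S_def x_def sklyanin_gen_def del: free_algebra_simps(6))
  qed
  show ?thesis
    using \<phi> cyclic_gens(1)[OF cyc] by (intro bexI[of _ \<phi>]) (auto simp: scaled_perm_def sm)
qed

lemma sklyanin_gen_closed: "sklyanin_gen \<alpha>\<^sub>1 \<alpha>\<^sub>2 \<alpha>\<^sub>3 g \<in> carrier (sklyanin_algebra \<alpha>\<^sub>1 \<alpha>\<^sub>2 \<alpha>\<^sub>3)"
  by (auto simp: sklyanin_gen_def sklyanin_carrier)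

lemma alg_hom_closed: "h \<in> alg_hom A B \<Longrightarrow> x \<in> carrier A \<Longrightarrow> h x \<in> carrier B"
  by (auto simp: alg_hom_def Ring.ring_hom_def)

lemma alg_hom_smult: "h \<in> alg_hom A B \<Longrightarrow> x \<in> carrier A \<Longrightarrow> h (s \<odot>\<^bsub>A\<^esub> x) = s \<odot>\<^bsub>B\<^esub> h x"
  by (auto simp: alg_hom_def)

lemma id_alg_hom: "id \<in> alg_hom A A"
  by (auto simp: alg_hom_def Ring.ring_hom_def)

lemma scaled_perm_aut:
  fixes s0 s1 s2 s3 :: "'k::field"
  assumes cyc: "cyclic \<alpha>\<^sub>1 \<alpha>\<^sub>2 \<alpha>\<^sub>3 (i, j, k) (\<alpha>, \<beta>, \<gamma>)"
    and s: "s2 * s3 = - (s0 * s1)" "s0 * s2 = - (\<beta> * (s1 * s3))" "s0 * s3 = \<gamma> * (s1 * s2)"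
    and nz: "s0 \<noteq> 0" "s1 \<noteq> 0" "s2 \<noteq> 0" "s3 \<noteq> 0"
  defines "S \<equiv> sklyanin_algebra \<alpha>\<^sub>1 \<alpha>\<^sub>2 \<alpha>\<^sub>3" and "x \<equiv> sklyanin_gen \<alpha>\<^sub>1 \<alpha>\<^sub>2 \<alpha>\<^sub>3"
  shows "\<exists>\<phi> \<in> alg_aut S. \<phi> (x X0) = s0 \<odot>\<^bsub>S\<^esub> x i \<and> \<phi> (x i) = s1 \<odot>\<^bsub>S\<^esub> x X0 \<and>
    \<phi> (x j) = s2 \<odot>\<^bsub>S\<^esub> x k \<and> \<phi> (x k) = s3 \<odot>\<^bsub>S\<^esub> x j"
proof -
  interpret S: k_algebra S unfolding S_def by (rule k_algebra_sklyanin)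
  have s': "(1 / s3) * (1 / s2) = - ((1 / s1) * (1 / s0))"
    "(1 / s1) * (1 / s3) = - (\<beta> * ((1 / s0) * (1 / s2)))"
    "(1 / s1) * (1 / s2) = \<gamma> * ((1 / s0) * (1 / s3))"
  proof -
    have "\<beta> \<noteq> 0" "\<gamma> \<noteq> 0" using s nz by auto
    note nz = nz this
    show "(1 / s3) * (1 / s2) = - ((1 / s1) * (1 / s0))"
      using s(1) nz by (auto simp: divide_simps ac_simps)
    show "(1 / s1) * (1 / s3) = - (\<beta> * ((1 / s0) * (1 / s2)))"
      using s(2) nz by (auto simp: divide_simps ac_simps)
    show "(1 / s1) * (1 / s2) = \<gamma> * ((1 / s0) * (1 / s3))"
      using s(3) nz by (auto simp: divide_simps ac_simps)
  qed
  obtain \<phi> where \<phi>: "\<phi> \<in> alg_hom S S" "\<phi> (x X0) = s0 \<odot>\<^bsub>S\<^esub> x i" "\<phi> (x i) = s1 \<odot>\<^bsub>S\<^esub> x X0"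
    "\<phi> (x j) = s2 \<odot>\<^bsub>S\<^esub> x k" "\<phi> (x k) = s3 \<odot>\<^bsub>S\<^esub> x j"
    using scaled_perm_hom[OF cyc s] unfolding S_def x_def by blast
  obtain \<psi> where \<psi>: "\<psi> \<in> alg_hom S S" "\<psi> (x X0) = (1 / s1) \<odot>\<^bsub>S\<^esub> x i"
    "\<psi> (x i) = (1 / s0) \<odot>\<^bsub>S\<^esub> x X0" "\<psi> (x j) = (1 / s3) \<odot>\<^bsub>S\<^esub> x k" "\<psi> (x k) = (1 / s2) \<odot>\<^bsub>S\<^esub> x j"
    using scaled_perm_hom[OF cyc s'] unfolding S_def x_def by blast
  have xc: "x g \<in> carrier S" for g
    unfolding S_def x_def by (rule sklyanin_gen_closed)
  note v = alg_hom_smult[OF \<phi>(1) xc] alg_hom_smult[OF \<psi>(1) xc] \<phi>(2-) \<psi>(2-)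
    S.smult_assoc1[OF xc, symmetric] S.smult_one[OF xc]
  have g: "(\<psi> \<circ> \<phi>) (x g) = id (x g)" "(\<phi> \<circ> \<psi>) (x g) = id (x g)" for g
    using cyclic_gens(2)[OF cyc, of g] nz by (auto simp: v)
  have u: "\<chi> X = id X" if "\<chi> \<in> alg_hom S S" "\<And>g. \<chi> (x g) = id (x g)" "X \<in> carrier S" for \<chi> X
    using that unfolding S_def x_def
    by (rule sklyanin_hom_unique[OF k_algebra_sklyanin _ id_alg_hom])
  have inv: "(\<psi> \<circ> \<phi>) X = id X" "(\<phi> \<circ> \<psi>) X = id X" if "X \<in> carrier S" for X
    by (rule u[OF alg_hom_comp[OF \<phi>(1) \<psi>(1)] g(1) that], rule u[OF alg_hom_comp[OF \<psi>(1) \<phi>(1)] g(2) that])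
  have "bij_betw \<phi> (carrier S) (carrier S)"
    using alg_hom_closed[OF \<phi>(1)] alg_hom_closed[OF \<psi>(1)] inv
    by (intro bij_betw_byWitness[where f' = \<psi>]) (auto simp: image_subset_iff)
  then show ?thesis using \<phi> by (auto simp: alg_aut_def)
qed

theorem sklyanin_phi_exists:
  fixes a b c \<iota> :: "'k::field"
  assumes "\<alpha>\<^sub>1 \<noteq> 0" "\<alpha>\<^sub>2 \<noteq> 0" "\<alpha>\<^sub>3 \<noteq> 0" "a\<^sup>2 = \<alpha>\<^sub>1" "b\<^sup>2 = \<alpha>\<^sub>2" "c\<^sup>2 = \<alpha>\<^sub>3" "\<iota>\<^sup>2 = - 1" "j \<in> {1, 2, 3}"
  defines "S \<equiv> sklyanin_algebra \<alpha>\<^sub>1 \<alpha>\<^sub>2 \<alpha>\<^sub>3" and "x \<equiv> sklyanin_gen \<alpha>\<^sub>1 \<alpha>\<^sub>2 \<alpha>\<^sub>3"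
  shows "\<exists>\<phi> \<in> alg_aut S. gen_images x \<phi> (phi_values S x a b c \<iota> j)"
proof -
  have nz: "a \<noteq> 0" "b \<noteq> 0" "c \<noteq> 0" "\<iota> \<noteq> 0"
    using assms by auto
  have ii: "\<iota> * (\<iota> * u) = - u" for u
    using assms(7) by (simp add: power2_eq_square mult.assoc[symmetric])
  have "\<exists>\<phi> \<in> alg_aut S. \<phi> (x X0) = (b * c) \<odot>\<^bsub>S\<^esub> x X1 \<and> \<phi> (x X1) = (- \<iota>) \<odot>\<^bsub>S\<^esub> x X0 \<and>
      \<phi> (x X2) = (- \<iota> * b) \<odot>\<^bsub>S\<^esub> x X3 \<and> \<phi> (x X3) = (- c) \<odot>\<^bsub>S\<^esub> x X2"
    unfolding S_def x_def
    by (rule scaled_perm_aut[where \<alpha> = \<alpha>\<^sub>1 and \<beta> = \<alpha>\<^sub>2 and \<gamma> = \<alpha>\<^sub>3])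
       (use nz assms(4-7) in \<open>auto simp: cyclic_def power2_eq_square algebra_simps ii\<close>)
  moreover have "\<exists>\<phi> \<in> alg_aut S. \<phi> (x X0) = (a * c) \<odot>\<^bsub>S\<^esub> x X2 \<and> \<phi> (x X2) = (- \<iota>) \<odot>\<^bsub>S\<^esub> x X0 \<and>
      \<phi> (x X3) = (- \<iota> * c) \<odot>\<^bsub>S\<^esub> x X1 \<and> \<phi> (x X1) = (- a) \<odot>\<^bsub>S\<^esub> x X3"
    unfolding S_def x_def
    by (rule scaled_perm_aut[where \<alpha> = \<alpha>\<^sub>2 and \<beta> = \<alpha>\<^sub>3 and \<gamma> = \<alpha>\<^sub>1])
       (use nz assms(4-7) in \<open>auto simp: cyclic_def power2_eq_square algebra_simps ii\<close>)
  moreover have "\<exists>\<phi> \<in> alg_aut S. \<phi> (x X0) = (a * b) \<odot>\<^bsub>S\<^esub> x X3 \<and> \<phi> (x X3) = (- \<iota>) \<odot>\<^bsub>S\<^esub> x X0 \<and>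
      \<phi> (x X1) = (- \<iota> * a) \<odot>\<^bsub>S\<^esub> x X2 \<and> \<phi> (x X2) = (- b) \<odot>\<^bsub>S\<^esub> x X1"
    unfolding S_def x_def
    by (rule scaled_perm_aut[where \<alpha> = \<alpha>\<^sub>3 and \<beta> = \<alpha>\<^sub>1 and \<gamma> = \<alpha>\<^sub>2])
       (use nz assms(4-7) in \<open>auto simp: cyclic_def power2_eq_square algebra_simps ii\<close>)
  ultimately have
    "\<exists>\<phi> \<in> alg_aut S. gen_images x \<phi> (phi_values S x a b c \<iota> 1)"
    "\<exists>\<phi> \<in> alg_aut S. gen_images x \<phi> (phi_values S x a b c \<iota> 2)"
    "\<exists>\<phi> \<in> alg_aut S. gen_images x \<phi> (phi_values S x a b c \<iota> 3)"
    unfolding gen_images_def numeral_2_eq_2 numeral_3_eq_3 One_nat_def phi_values.simps prod.inject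
    by blast+
  then show ?thesis using assms(8) by blast
qed

end

theory Submission
  imports Defs
begin

text \<open>
  The matrices \<open>q\<^sub>1, q\<^sub>2, q\<^sub>3\<close> are a matrix model of the quaternion units: they anticommute, and
  \<open>q\<^sub>i q\<^sub>j = q\<^sub>k\<close> for every cyclic permutation \<open>(i, j, k)\<close> of \<open>(1, 2, 3)\<close>. For \<open>x\<^sub>0 \<mapsto> 1\<close> and
  \<open>x\<^sub>i \<mapsto> q\<^sub>i\<close> both sides of the first family of relations vanish, and both
  sides of the second are \<open>2 q\<^sub>i\<close>. Hence \<open>\<rho>\<^sub>0\<close> exists (\<open>rho_0_exists\<close>). No further relation has
  to be checked: the values prescribed for \<open>\<rho>\<^sub>j\<close> are those of \<open>\<rho>\<^sub>0 \<circ> \<phi>\<^sub>j\<close> (\<open>rho_0_comp_phi\<close>), and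
  the automorphism \<open>\<phi>\<^sub>j\<close> exists (\<open>sklyanin_phi_exists\<close>). As a homomorphism is determined by its values on the
  generators, \<open>\<rho>\<^sub>j = \<rho>\<^sub>0 \<circ> \<phi>\<^sub>j\<close> for every homomorphism \<open>\<rho>\<^sub>j\<close> with these values, so that the
  identity of \<open>k\<^sup>2\<close> is an isomorphism from \<open>V(\<tau> + \<xi>\<^sub>j)\<close> to \<open>\<phi>\<^sub>j\<^sup>* V(\<tau>)\<close>.

  Simplicity holds because, for each \<open>j\<close>, some generator acts as a nonzero multiple of
  \<open>q\<^sub>1\<close> and some generator as a nonzero multiple of \<open>q\<^sub>2\<close> (\<open>simple_rep_module\<close>): the first gives
  the projections to the coordinate axes, since \<open>2\<close> is invertible, and the second exchanges the
  axes.

  The modules are told apart by the generator that acts as a scalar: on \<open>V(\<tau> + \<xi>\<^sub>j)\<close> it is \<open>x\<^sub>j\<close>,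
  with scalar \<open>1\<close> or \<open>-\<iota>\<close>, while on the other three modules \<open>x\<^sub>j\<close> is a multiple of some \<open>q\<^sub>m\<close>, which
  has trace zero. An isomorphism would carry the first action to the second
  (\<open>rep_module_iso_scalar\<close>), and a nonzero scalar matrix of size two has nonzero trace when
  \<open>2 \<noteq> 0\<close>.
\<close>

section \<open>Two-by-two matrices\<close>

abbreviation mat2 :: "'k::field \<Rightarrow> 'k \<Rightarrow> 'k \<Rightarrow> 'k \<Rightarrow> 'k mat" where
  "mat2 p q r s \<equiv> mat_of_rows_list 2 [[p, q], [r, s]]"

definition vec2 :: "'k::field \<Rightarrow> 'k \<Rightarrow> 'k vec" where
  "vec2 u v = vec 2 (\<lambda>i. if i = 0 then u else v)"

lemma less_2_iff: "i < Suc (Suc 0) \<longleftrightarrow> i = 0 \<or> i = Suc 0"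
  by auto

lemma mat2_carrier [simp]: "mat2 p q r s \<in> carrier_mat 2 2"
  by (simp add: mat_of_rows_list_def numeral_2_eq_2)

lemma vec2_carrier [simp]: "vec2 u v \<in> carrier_vec 2"
  by (simp add: vec2_def)

lemma mat2_arith:
  "mat2 p q r s + mat2 p' q' r' s' = mat2 (p + p') (q + q') (r + r') (s + s')"
  "mat2 p q r s - mat2 p' q' r' s' = mat2 (p - p') (q - q') (r - r') (s - s')"
  "mat2 p q r s * mat2 p' q' r' s' =
     mat2 (p * p' + q * r') (p * q' + q * s') (r * p' + s * r') (r * q' + s * s')"
  "t \<cdot>\<^sub>m mat2 p q r s = mat2 (t * p) (t * q) (t * r) (t * s)"
  "1\<^sub>m 2 = mat2 1 0 0 1"
  "0\<^sub>m 2 2 = mat2 0 0 0 0"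
  by (auto intro!: eq_matI simp: mat_of_rows_list_def scalar_prod_def less_2_iff numeral_2_eq_2)

lemma mat2_eq_iff: "mat2 p q r s = mat2 p' q' r' s' \<longleftrightarrow> p = p' \<and> q = q' \<and> r = r' \<and> s = s'"
proof
  assume "mat2 p q r s = mat2 p' q' r' s'"
  then have "mat2 p q r s $$ ij = mat2 p' q' r' s' $$ ij" for ij by simp
  from this[of "(0, 0)"] this[of "(0, 1)"] this[of "(1, 0)"] this[of "(1, 1)"]
  show "p = p' \<and> q = q' \<and> r = r' \<and> s = s'" by (simp add: mat_of_rows_list_def)
qed simp

lemma vec2_arith:
  "vec2 u v + vec2 u' v' = vec2 (u + u') (v + v')"
  "t \<cdot>\<^sub>v vec2 u v = vec2 (t * u) (t * v)"
  "mat2 p q r s *\<^sub>v vec2 u v = vec2 (p * u + q * v) (r * u + s * v)"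
  "0\<^sub>v 2 = vec2 0 0"
  by (auto intro!: eq_vecI simp: vec2_def mat_of_rows_list_def scalar_prod_def less_2_iff numeral_2_eq_2)

lemma vec2_eq_iff: "vec2 u v = vec2 u' v' \<longleftrightarrow> u = u' \<and> v = v'"
proof
  assume "vec2 u v = vec2 u' v'"
  then have "vec2 u v $ i = vec2 u' v' $ i" for i by simp
  from this[of 0] this[of 1] show "u = u' \<and> v = v'" by (simp add: vec2_def)
qed simp

lemma vec2_cases:
  assumes "w \<in> carrier_vec 2"
  obtains u v where "w = vec2 u v"
proof
  show "w = vec2 (w $ 0) (w $ 1)"
    using assms by (auto intro!: eq_vecI simp: vec2_def less_2_iff numeral_2_eq_2)
qed

lemma smult_one_mult_vec:
  fixes v :: "'k::field vec"
  shows "v \<in> carrier_vec n \<Longrightarrow> (s \<cdot>\<^sub>m 1\<^sub>m n) *\<^sub>v v = s \<cdot>\<^sub>v v"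
  by (intro eq_vecI) auto


section \<open>Modules of column vectors\<close>

lemma mat_algebra_simps [simp]:
  "carrier (mat_algebra n) = carrier_mat n n"
  "mult (mat_algebra n) = (*)" "one (mat_algebra n) = 1\<^sub>m n"
  "zero (mat_algebra n) = 0\<^sub>m n n" "add (mat_algebra n) = (+)"
  "module.smult (mat_algebra n) = (\<cdot>\<^sub>m)"
  by (simp_all add: mat_algebra_def ring_mat_def module.fields_def)

lemma k_algebra_mat: "k_algebra (mat_algebra n :: ('k::field, 'k mat) module)"
proof -
  interpret ring "mat_algebra n :: ('k, 'k mat) module"
    unfolding mat_algebra_def by (rule ring_mat)
  show ?thesis
    by unfold_locales
      (auto simp: add_smult_distrib_left_mat add_smult_distrib_right_mat)
qed

lemma rep_module_simps [simp]:
  "carrier (rep_module n \<rho>) = carrier_vec n" "add (rep_module n \<rho>) = (+)"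
  "zero (rep_module n \<rho>) = 0\<^sub>v n" "module.smult (rep_module n \<rho>) = (\<lambda>r v. \<rho> r *\<^sub>v v)"
  by (simp_all add: rep_module_def ring.extend_def ring.truncate_def module.fields_def
      module_vec_def)

lemma pullback_simps [simp]:
  "carrier (pullback \<psi> M) = carrier M" "add (pullback \<psi> M) = add M"
  "zero (pullback \<psi> M) = zero M"
  "module.smult (pullback \<psi> M) = (\<lambda>r. module.smult M (\<psi> r))"
  by (simp_all add: pullback_def ring.extend_def ring.truncate_def module.fields_def)

lemma abelian_group_vec_carrier:
  fixes M :: "('r, 'k::field vec, 'm) module_scheme"
  assumes "carrier M = carrier_vec n" "add M = (+)" "zero M = 0\<^sub>v n"
  shows "abelian_group M"
proof (intro abelian_groupI, unfold assms, goal_cases)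
  case (6 v)
  then show ?case by (intro bexI[of _ "- v"]) auto
qed (auto simp: ac_simps)

lemma mat_hom_simps:
  assumes "\<rho> \<in> alg_hom A (mat_algebra n)"
  shows "x \<in> carrier A \<Longrightarrow> \<rho> x \<in> carrier_mat n n"
    and "x \<in> carrier A \<Longrightarrow> y \<in> carrier A \<Longrightarrow> \<rho> (x \<oplus>\<^bsub>A\<^esub> y) = \<rho> x + \<rho> y"
    and "x \<in> carrier A \<Longrightarrow> y \<in> carrier A \<Longrightarrow> \<rho> (x \<otimes>\<^bsub>A\<^esub> y) = \<rho> x * \<rho> y"
    and "\<rho> \<one>\<^bsub>A\<^esub> = 1\<^sub>m n"
    and "x \<in> carrier A \<Longrightarrow> \<rho> (s \<odot>\<^bsub>A\<^esub> x) = s \<cdot>\<^sub>m \<rho> x"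
  using assms by (auto simp: alg_hom_def Ring.ring_hom_def)

lemma left_module_rep_module:
  fixes A :: "('k::field, 'a) module"
  assumes "k_algebra A" "\<rho> \<in> alg_hom A (mat_algebra n)"
  shows "left_module A (rep_module n \<rho>)"
proof -
  interpret k_algebra A by fact
  note \<rho> = mat_hom_simps[OF assms(2)]
  note distrib = add_mult_distrib_mat_vec[OF \<rho>(1) \<rho>(1)] mult_add_distrib_mat_vec[OF \<rho>(1)]
    assoc_mult_mat_vec[OF \<rho>(1) \<rho>(1)]
  show ?thesis
    by (intro left_module.intro left_module_axioms.intro abelian_group_vec_carrier ring_axioms)
      (auto simp: \<rho>(2-4) distrib intro: mult_mat_vec_carrier[OF \<rho>(1)])
qed

text \<open>The scalars act through \<open>\<rho>(s \<cdot> 1) = s \<cdot> 1\<close>, so on \<open>k\<^sup>n\<close> the vector space underlying the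
  module is the standard one. The two records may still differ outside \<open>k\<^sup>n\<close>, whence the
  dimension is transported along the identity map instead of an equation.\<close>

lemma left_module_of_dim_rep_module:
  fixes A :: "('k::field, 'a) module"
  assumes "k_algebra A" "\<rho> \<in> alg_hom A (mat_algebra n)"
  shows "left_module_of_dim A (rep_module n \<rho>) n"
proof -
  interpret A: k_algebra A by fact
  let ?K = "class_ring :: 'k ring"
  let ?V = "module_vec TYPE('k) n"
  define U where "U = pullback (\<lambda>s. s \<odot>\<^bsub>A\<^esub> \<one>\<^bsub>A\<^esub>) (rep_module n \<rho>)"
  have U: "carrier U = carrier_vec n" "add U = (+)" "zero U = 0\<^sub>v n"
    by (simp_all add: U_def)
  have sm: "s \<odot>\<^bsub>U\<^esub> v = s \<cdot>\<^sub>v v" if "v \<in> carrier_vec n" for s v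
    using that by (simp add: U_def mat_hom_simps[OF assms(2)] smult_one_mult_vec)
  interpret V: vec_space "TYPE('k)" n .
  have "Module.module ?K U"
    by (intro moduleI abelian_group_vec_carrier[OF U])
      (auto simp: U sm smult_add_distrib_vec add_smult_distrib_vec smult_smult_assoc
        intro: class_cring.cring_axioms)
  then interpret U: vectorspace ?K U
    by (intro vectorspace.intro class_field)
  have "linear_map ?K ?V U id"
    by (intro linear_map.intro mod_hom.intro mod_hom_axioms.intro V.vectorspace_axioms
        U.vectorspace_axioms V.module_axioms U.module_axioms)
      (auto simp: LinearCombinations.module_hom_def U sm module_vec_simps)
  then interpret L: linear_map ?K ?V U id .
  have surj: "id ` carrier ?V = carrier U" by (simp add: U module_vec_simps)
  have "U.fin_dim" by (rule L.surj_fin_dim[OF _ surj]) simp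
  moreover have "U.dim = n"
    using L.dim_eq[OF _ _ surj] V.dim_is_n by simp
  ultimately show ?thesis
    using U.vectorspace_axioms left_module_rep_module[OF assms]
    by (simp add: left_module_of_dim_def U_def)
qed

lemma mat_eq_if_mult_vec_eq:
  fixes A B :: "'k::field mat"
  assumes A: "A \<in> carrier_mat m n" and B: "B \<in> carrier_mat m n"
    and eq: "\<And>v. v \<in> carrier_vec n \<Longrightarrow> A *\<^sub>v v = B *\<^sub>v v"
  shows "A = B"
proof (rule eq_matI)
  fix i j assume ij: "i < dim_row B" "j < dim_col B"
  have entry: "(M *\<^sub>v unit_vec n j) $ i = M $$ (i, j)" if "M \<in> carrier_mat m n" for M :: "'k mat"
    using ij that B by (auto simp: scalar_prod_right_unit)
  show "A $$ (i, j) = B $$ (i, j)"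
    using entry[OF A] entry[OF B] eq[OF unit_vec_carrier, of j] by simp
qed (use A B in auto)

text \<open>A module isomorphism over a \<open>k\<close>-algebra is \<open>k\<close>-linear: it commutes with \<open>s \<cdot> 1\<close>, an element of
  the algebra. Hence it conjugates \<open>\<rho> x\<close> into \<open>\<rho>' x\<close>, and conjugation does not change a
  scalar matrix.\<close>

lemma rep_module_iso_scalar:
  fixes A :: "('k::field, 'a) module"
  assumes iso: "left_module_iso A (rep_module n \<rho>) (rep_module n \<rho>')"
    and A: "k_algebra A"
    and hom: "\<rho> \<in> alg_hom A (mat_algebra n)" "\<rho>' \<in> alg_hom A (mat_algebra n)"
    and x: "x \<in> carrier A" "\<rho> x = s \<cdot>\<^sub>m 1\<^sub>m n"
  shows "\<rho>' x = s \<cdot>\<^sub>m 1\<^sub>m n"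
proof (rule mat_eq_if_mult_vec_eq)
  interpret k_algebra A by fact
  fix w :: "'k vec" assume w: "w \<in> carrier_vec n"
  obtain f where f: "f \<in> LinearCombinations.module_hom A (rep_module n \<rho>) (rep_module n \<rho>')"
    "bij_betw f (carrier_vec n) (carrier_vec n)"
    using iso by (auto simp: left_module_iso_def)
  have f_act: "f (\<rho> y *\<^sub>v v) = \<rho>' y *\<^sub>v f v" if "y \<in> carrier A" "v \<in> carrier_vec n" for y v
    using f(1) that by (auto simp: LinearCombinations.module_hom_def)
  obtain v where v: "v \<in> carrier_vec n" "w = f v"
    using f(2) w by (auto simp: bij_betw_def)
  define y where "y = s \<odot>\<^bsub>A\<^esub> \<one>\<^bsub>A\<^esub>"
  have y: "y \<in> carrier A" "\<rho> y = \<rho> x" "\<rho>' y = s \<cdot>\<^sub>m 1\<^sub>m n"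
    by (simp_all add: y_def smult_closed mat_hom_simps[OF hom(1)] mat_hom_simps[OF hom(2)] x)
  show "\<rho>' x *\<^sub>v w = (s \<cdot>\<^sub>m 1\<^sub>m n) *\<^sub>v w"
    using f_act[OF x(1) v(1)] f_act[OF y(1) v(1)] y v by simp
qed (use mat_hom_simps(1)[OF hom(2) x(1)] in \<open>auto intro: smult_carrier_mat\<close>)

lemma rep_module_iso_pullback:
  assumes "\<And>x. x \<in> carrier A \<Longrightarrow> \<rho>' x = \<rho> (\<psi> x)"
  shows "left_module_iso A (rep_module n \<rho>') (pullback \<psi> (rep_module n \<rho>))"
  unfolding left_module_iso_def
  by (rule bexI[of _ id]) (auto simp: LinearCombinations.module_hom_def assms)

text \<open>A submodule is stable under scaling, hence under \<open>-\<iota> q\<^sub>1 = diag(1, -1)\<close> and under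
  \<open>-\<iota> q\<^sub>2\<close>, the exchange of the coordinates. Half the sum of \<open>1\<close> and \<open>diag(1, -1)\<close> is the
  projection to the first axis. So a nonzero submodule contains both axes.\<close>

lemma simple_rep_module:
  fixes A :: "('k::field, 'a) module"
  assumes A: "k_algebra A" and hom: "\<rho> \<in> alg_hom A (mat_algebra 2)"
    and two: "(2::'k) \<noteq> 0" and \<iota>: "\<iota>\<^sup>2 = - 1"
    and x: "x \<in> carrier A" "\<rho> x = s \<cdot>\<^sub>m q\<^sub>1 \<iota>" "s \<noteq> 0"
    and y: "y \<in> carrier A" "\<rho> y = t \<cdot>\<^sub>m q\<^sub>2 \<iota>" "t \<noteq> 0"
  shows "simple_left_module A (rep_module 2 \<rho>)"
proof -
  interpret k_algebra A by fact
  let ?V = "rep_module 2 \<rho>"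
  have ii: "\<iota> * \<iota> = - 1" "\<iota> * (\<iota> * z) = - z" for z
    using \<iota> by (simp_all add: power2_eq_square mult.assoc[symmetric])
  have "N = carrier_vec 2" if N: "Module.submodule N A ?V" and ne: "N \<noteq> {0\<^sub>v 2}" for N
  proof -
    have sub: "N \<subseteq> carrier_vec 2" "0\<^sub>v 2 \<in> N" and add: "\<And>v w. v \<in> N \<Longrightarrow> w \<in> N \<Longrightarrow> v + w \<in> N"
      using Module.submodule.axioms(1)[OF N] by (auto simp: subgroup_def)
    have act: "\<rho> z *\<^sub>v v \<in> N" if "z \<in> carrier A" "v \<in> N" for z v
      using Module.submodule.smult_closed[OF N] that by simp
    have scale: "vec2 (r * u) (r * v) \<in> N" if "vec2 u v \<in> N" for r u v
      using act[of "r \<odot>\<^bsub>A\<^esub> \<one>\<^bsub>A\<^esub>", OF _ that]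
      by (simp add: smult_closed mat_hom_simps[OF hom] smult_one_mult_vec vec2_arith)
    have add2: "vec2 (u + u') (v + v') \<in> N" if "vec2 u v \<in> N" "vec2 u' v' \<in> N" for u v u' v'
      using add[OF that] by (simp add: vec2_arith)
    \<comment> \<open>The factors \<open>- \<iota> / s\<close> and \<open>- \<iota> / t\<close> turn the actions of \<open>x\<close> and \<open>y\<close> into the sign change
      of the second coordinate and the exchange of the coordinates, as \<open>- \<iota> * \<iota> = 1\<close>.\<close>
    have flip: "vec2 u (- v) \<in> N" if "vec2 u v \<in> N" for u v
      using scale[of _ _ "- \<iota> / s", OF act[OF x(1) that, unfolded x(2) q\<^sub>1_def mat2_arith vec2_arith]]
        x(3) by (simp add: ii)
    have swap: "vec2 v u \<in> N" if "vec2 u v \<in> N" for u v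
      using scale[of _ _ "- \<iota> / t", OF act[OF y(1) that, unfolded y(2) q\<^sub>2_def mat2_arith vec2_arith]]
        y(3) by (simp add: ii)
    have proj: "vec2 u 0 \<in> N" if "vec2 u v \<in> N" for u v
      using scale[of _ _ "1 / 2", OF add2[OF that flip[OF that]]] two by (simp add: field_simps)
    obtain u v where uv: "vec2 u v \<in> N" "u \<noteq> 0 \<or> v \<noteq> 0"
    proof -
      obtain w where "w \<in> N" "w \<noteq> 0\<^sub>v 2" using ne sub(2) by blast
      moreover from this obtain u v where "w = vec2 u v" using sub(1) vec2_cases by blast
      ultimately show ?thesis using that by (auto simp: vec2_arith vec2_eq_iff)
    qed
    obtain u where "vec2 u 0 \<in> N" "u \<noteq> 0"
      using uv proj[OF uv(1)] proj[OF swap[OF uv(1)]] by blast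
    then have e: "vec2 r 0 \<in> N" for r using scale[of u 0 "r / u"] by simp
    have "vec2 r r' \<in> N" for r r' using add2[OF e[of r] swap[OF e[of r']]] by simp
    then show ?thesis using sub(1) vec2_cases by blast
  qed
  moreover have "vec2 1 0 \<in> carrier_vec 2 \<and> vec2 1 0 \<noteq> (0\<^sub>v 2 :: 'k vec)"
    by (simp add: vec2_arith vec2_eq_iff)
  then have "carrier_vec 2 \<noteq> {0\<^sub>v 2 :: 'k vec}" by blast
  ultimately show ?thesis
    using left_module_rep_module[OF A hom] by (auto simp: simple_left_module_def)
qed


section \<open>The four representations\<close>

lemma values_numeral:
  "rho_values a b c \<iota> 2 = ((a * c) \<cdot>\<^sub>m q\<^sub>2 \<iota>, (- a) \<cdot>\<^sub>m q\<^sub>3, (- \<iota>) \<cdot>\<^sub>m 1\<^sub>m 2, (- \<iota> * c) \<cdot>\<^sub>m q\<^sub>1 \<iota>)"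
  "rho_values a b c \<iota> 3 = ((a * b) \<cdot>\<^sub>m q\<^sub>3, (- \<iota> * a) \<cdot>\<^sub>m q\<^sub>2 \<iota>, (- b) \<cdot>\<^sub>m q\<^sub>1 \<iota>, (- \<iota>) \<cdot>\<^sub>m 1\<^sub>m 2)"
  "phi_values S x a b c \<iota> 2 =
     ((a * c) \<odot>\<^bsub>S\<^esub> x X2, (- a) \<odot>\<^bsub>S\<^esub> x X3, (- \<iota>) \<odot>\<^bsub>S\<^esub> x X0, (- \<iota> * c) \<odot>\<^bsub>S\<^esub> x X1)"
  "phi_values S x a b c \<iota> 3 =
     ((a * b) \<odot>\<^bsub>S\<^esub> x X3, (- \<iota> * a) \<odot>\<^bsub>S\<^esub> x X2, (- b) \<odot>\<^bsub>S\<^esub> x X1, (- \<iota>) \<odot>\<^bsub>S\<^esub> x X0)"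
  by (simp_all add: numeral_2_eq_2 numeral_3_eq_3)

lemma rho_0_exists:
  fixes a b c \<iota> :: "'k::field"
  assumes \<iota>: "\<iota>\<^sup>2 = - 1"
  shows "\<exists>\<rho> \<in> alg_hom (sklyanin_algebra \<alpha>\<^sub>1 \<alpha>\<^sub>2 \<alpha>\<^sub>3) (mat_algebra 2).
    gen_images (sklyanin_gen \<alpha>\<^sub>1 \<alpha>\<^sub>2 \<alpha>\<^sub>3) \<rho> (rho_values a b c \<iota> 0)"
proof -
  define f where "f = case_gen (1\<^sub>m 2) (q\<^sub>1 \<iota>) (q\<^sub>2 \<iota>) q\<^sub>3"
  define h where "h = k_algebra.free_lift (mat_algebra 2) f"
  have f: "range f \<subseteq> carrier (mat_algebra 2)"
    by (auto simp: f_def q\<^sub>1_def q\<^sub>2_def q\<^sub>3_def split: gen.split)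
  have h: "h \<in> alg_hom free_algebra (mat_algebra 2)"
    unfolding h_def by (rule k_algebra.free_lift_hom[OF k_algebra_mat f])
  have hg: "h (free_gen g) = f g" for g
    unfolding h_def by (rule k_algebra.free_lift_gen[OF k_algebra_mat f])
  note hs = mat_hom_simps[OF h, simplified]
  have h_diff: "h (p - q) = h p - h q" for p q
  proof -
    have "h p = h (p - q) + h q" using hs(2)[of "p - q" q] by simp
    then show ?thesis
      using hs(1)[of "p - q"] hs(1)[of q] by (auto intro!: eq_matI)
  qed
  have h_scalar: "h (Poly_Mapping.single 0 s) = s \<cdot>\<^sub>m 1\<^sub>m 2" for s
    using hs(4) hs(5)[of s 1] by simp
  have \<iota>2: "\<iota> * \<iota> = - 1" using \<iota> by (simp add: power2_eq_square)
  have "h r = 0\<^sub>m 2 2" if "r \<in> sklyanin_rels \<alpha>\<^sub>1 \<alpha>\<^sub>2 \<alpha>\<^sub>3" for r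
    using that unfolding sklyanin_rels_def Let_def
    by (auto simp: h_diff h_scalar hs(2,3) hg f_def q\<^sub>1_def q\<^sub>2_def q\<^sub>3_def mat2_arith mat2_eq_iff \<iota>2)
  then show ?thesis
    using sklyanin_hom_exists[OF k_algebra_mat h, of \<alpha>\<^sub>1 \<alpha>\<^sub>2 \<alpha>\<^sub>3]
    unfolding gen_images_def by (auto simp: hg f_def elim!: bexI[rotated])
qed

text \<open>The entries of \<open>phi_values\<close> are scaled generators, and replacing each generator in them by its
  image under \<open>\<rho>\<^sub>0\<close> gives the entries of \<open>rho_values\<close> at the same index.\<close>

lemma rho_0_comp_phi:
  fixes \<alpha>\<^sub>1 \<alpha>\<^sub>2 \<alpha>\<^sub>3 a b c \<iota> :: "'k::field"
  defines "S \<equiv> sklyanin_algebra \<alpha>\<^sub>1 \<alpha>\<^sub>2 \<alpha>\<^sub>3" and "x \<equiv> sklyanin_gen \<alpha>\<^sub>1 \<alpha>\<^sub>2 \<alpha>\<^sub>3"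
  assumes \<rho>: "\<rho> \<in> alg_hom S (mat_algebra 2)" "gen_images x \<rho> (rho_values a b c \<iota> 0)"
    and \<phi>: "gen_images x \<phi> (phi_values S x a b c \<iota> j)" and j: "j \<in> {1, 2, 3}"
  shows "gen_images x (\<rho> \<circ> \<phi>) (rho_values a b c \<iota> j)"
proof -
  have xc: "x g \<in> carrier S" for g unfolding S_def x_def by (rule sklyanin_gen_closed)
  show ?thesis
    using j \<rho>(2) \<phi>
    by (auto simp: gen_images_def values_numeral mat_hom_simps(5)[OF \<rho>(1) xc])
qed

lemma rho_exists:
  fixes a b c \<iota> :: "'k::field"
  assumes "\<alpha>\<^sub>1 \<noteq> 0" "\<alpha>\<^sub>2 \<noteq> 0" "\<alpha>\<^sub>3 \<noteq> 0" "a\<^sup>2 = \<alpha>\<^sub>1" "b\<^sup>2 = \<alpha>\<^sub>2" "c\<^sup>2 = \<alpha>\<^sub>3" "\<iota>\<^sup>2 = - 1"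
    and j: "j \<in> {0, 1, 2, 3}"
  shows "\<exists>\<rho> \<in> alg_hom (sklyanin_algebra \<alpha>\<^sub>1 \<alpha>\<^sub>2 \<alpha>\<^sub>3) (mat_algebra 2).
    gen_images (sklyanin_gen \<alpha>\<^sub>1 \<alpha>\<^sub>2 \<alpha>\<^sub>3) \<rho> (rho_values a b c \<iota> j)"
proof (cases "j = 0")
  case True
  then show ?thesis using rho_0_exists[OF assms(7)] by simp
next
  case False
  with j have j': "j \<in> {1, 2, 3}" by simp
  obtain \<rho> where \<rho>: "\<rho> \<in> alg_hom (sklyanin_algebra \<alpha>\<^sub>1 \<alpha>\<^sub>2 \<alpha>\<^sub>3) (mat_algebra 2)"
    "gen_images (sklyanin_gen \<alpha>\<^sub>1 \<alpha>\<^sub>2 \<alpha>\<^sub>3) \<rho> (rho_values a b c \<iota> 0)"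
    using rho_0_exists[OF assms(7)] by blast
  obtain \<phi> where \<phi>: "\<phi> \<in> alg_aut (sklyanin_algebra \<alpha>\<^sub>1 \<alpha>\<^sub>2 \<alpha>\<^sub>3)"
    "gen_images (sklyanin_gen \<alpha>\<^sub>1 \<alpha>\<^sub>2 \<alpha>\<^sub>3) \<phi>
      (phi_values (sklyanin_algebra \<alpha>\<^sub>1 \<alpha>\<^sub>2 \<alpha>\<^sub>3) (sklyanin_gen \<alpha>\<^sub>1 \<alpha>\<^sub>2 \<alpha>\<^sub>3) a b c \<iota> j)"
    using sklyanin_phi_exists[OF assms(1-7) j'] by blast
  have "\<phi> \<in> alg_hom (sklyanin_algebra \<alpha>\<^sub>1 \<alpha>\<^sub>2 \<alpha>\<^sub>3) (sklyanin_algebra \<alpha>\<^sub>1 \<alpha>\<^sub>2 \<alpha>\<^sub>3)"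
    using \<phi>(1) by (simp add: alg_aut_def)
  then show ?thesis
    using alg_hom_comp[OF _ \<rho>(1)] rho_0_comp_phi[OF \<rho> \<phi>(2) j'] by blast
qed

lemma gen_images_determine_hom:
  assumes "\<rho> \<in> alg_hom (sklyanin_algebra \<alpha>\<^sub>1 \<alpha>\<^sub>2 \<alpha>\<^sub>3) B" "k_algebra B"
    "\<rho>' \<in> alg_hom (sklyanin_algebra \<alpha>\<^sub>1 \<alpha>\<^sub>2 \<alpha>\<^sub>3) B"
    "gen_images (sklyanin_gen \<alpha>\<^sub>1 \<alpha>\<^sub>2 \<alpha>\<^sub>3) \<rho> ys" "gen_images (sklyanin_gen \<alpha>\<^sub>1 \<alpha>\<^sub>2 \<alpha>\<^sub>3) \<rho>' ys"
    "X \<in> carrier (sklyanin_algebra \<alpha>\<^sub>1 \<alpha>\<^sub>2 \<alpha>\<^sub>3)"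
  shows "\<rho> X = \<rho>' X"
proof (rule sklyanin_hom_unique[OF assms(2,1,3) _ assms(6)])
  fix g
  show "\<rho> (sklyanin_gen \<alpha>\<^sub>1 \<alpha>\<^sub>2 \<alpha>\<^sub>3 g) = \<rho>' (sklyanin_gen \<alpha>\<^sub>1 \<alpha>\<^sub>2 \<alpha>\<^sub>3 g)"
    using assms(4,5) by (cases g) (auto simp: gen_images_def)
qed

text \<open>This selects among the homomorphisms that agree on \<open>carrier A\<close> the one that is \<open>undefined\<close>
  elsewhere; only so is uniqueness an equation of functions.\<close>

lemma alg_hom_restrict:
  assumes "ring A" "h \<in> alg_hom A B" "\<And>s x. x \<in> carrier A \<Longrightarrow> s \<odot>\<^bsub>A\<^esub> x \<in> carrier A"
  shows "restrict h (carrier A) \<in> alg_hom A B"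
proof -
  interpret ring A by fact
  show ?thesis using assms(2,3) by (auto simp: alg_hom_def Ring.ring_hom_def)
qed

lemma rho_module_simple:
  fixes \<alpha>\<^sub>1 \<alpha>\<^sub>2 \<alpha>\<^sub>3 a b c \<iota> :: "'k::field"
  defines "S \<equiv> sklyanin_algebra \<alpha>\<^sub>1 \<alpha>\<^sub>2 \<alpha>\<^sub>3" and "x \<equiv> sklyanin_gen \<alpha>\<^sub>1 \<alpha>\<^sub>2 \<alpha>\<^sub>3"
  assumes \<rho>: "\<rho> \<in> alg_hom S (mat_algebra 2)" "gen_images x \<rho> (rho_values a b c \<iota> j)"
    and j: "j \<in> {0, 1, 2, 3}"
    and nz: "(2::'k) \<noteq> 0" "\<iota>\<^sup>2 = - 1" "a \<noteq> 0" "b \<noteq> 0" "c \<noteq> 0"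
  shows "simple_left_module S (rep_module 2 \<rho>)"
proof -
  have "\<iota> \<noteq> 0" using nz(2) by auto
  have 1: "1 \<cdot>\<^sub>m q\<^sub>1 \<iota> = q\<^sub>1 \<iota>" "1 \<cdot>\<^sub>m q\<^sub>2 \<iota> = q\<^sub>2 \<iota>"
    by (simp_all add: q\<^sub>1_def q\<^sub>2_def mat2_arith)
  \<comment> \<open>\<open>q\<^sub>1\<close> and \<open>q\<^sub>2\<close> occur exactly once among the four values, up to the listed factors.\<close>
  have "\<rho> (x ([X1, X0, X3, X2] ! j)) = [1, b * c, - \<iota> * c, - b] ! j \<cdot>\<^sub>m q\<^sub>1 \<iota>"
    "[1, b * c, - \<iota> * c, - b] ! j \<noteq> 0"
    "\<rho> (x ([X2, X3, X0, X1] ! j)) = [1, - c, a * c, - \<iota> * a] ! j \<cdot>\<^sub>m q\<^sub>2 \<iota>"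
    "[1, - c, a * c, - \<iota> * a] ! j \<noteq> 0"
    using j \<rho>(2) nz(3-5) \<open>\<iota> \<noteq> 0\<close>
    by (auto simp: gen_images_def values_numeral 1)
  moreover have "x g \<in> carrier S" for g unfolding S_def x_def by (rule sklyanin_gen_closed)
  ultimately show ?thesis
    using simple_rep_module[OF k_algebra_sklyanin \<rho>(1)[unfolded S_def] nz(1,2)]
    unfolding S_def by blast
qed

lemma rho_modules_not_iso:
  fixes \<alpha>\<^sub>1 \<alpha>\<^sub>2 \<alpha>\<^sub>3 a b c \<iota> :: "'k::field"
  defines "S \<equiv> sklyanin_algebra \<alpha>\<^sub>1 \<alpha>\<^sub>2 \<alpha>\<^sub>3" and "x \<equiv> sklyanin_gen \<alpha>\<^sub>1 \<alpha>\<^sub>2 \<alpha>\<^sub>3"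
  assumes \<rho>: "\<rho> \<in> alg_hom S (mat_algebra 2)" "gen_images x \<rho> (rho_values a b c \<iota> j)"
    and \<rho>': "\<rho>' \<in> alg_hom S (mat_algebra 2)" "gen_images x \<rho>' (rho_values a b c \<iota> l)"
    and jl: "j \<in> {0, 1, 2, 3}" "l \<in> {0, 1, 2, 3}" "j \<noteq> l"
    and nz: "(2::'k) \<noteq> 0" "\<iota>\<^sup>2 = - 1"
  shows "\<not> left_module_iso S (rep_module 2 \<rho>) (rep_module 2 \<rho>')"
proof
  assume iso: "left_module_iso S (rep_module 2 \<rho>) (rep_module 2 \<rho>')"
  have "\<iota> \<noteq> 0" using nz(2) by auto
  have one: "1 \<cdot>\<^sub>m 1\<^sub>m 2 = (1\<^sub>m 2 :: 'k mat)" by (simp add: mat2_arith)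
  \<comment> \<open>The generator \<open>x\<^sub>j\<close> and the scalar \<open>s\<close> by which it acts on the module of index \<open>j\<close>.\<close>
  define g where "g = [X0, X1, X2, X3] ! j"
  define s where "s = [1, - \<iota>, - \<iota>, - \<iota>] ! j"
  have s: "\<rho> (x g) = s \<cdot>\<^sub>m 1\<^sub>m 2" "s \<noteq> 0"
    using jl(1) \<rho>(2) \<open>\<iota> \<noteq> 0\<close>
    by (auto simp: g_def s_def gen_images_def values_numeral one)
  have "\<rho>' (x g) = s \<cdot>\<^sub>m 1\<^sub>m 2"
    using rep_module_iso_scalar[OF iso _ \<rho>(1) \<rho>'(1) _ s(1)] k_algebra_sklyanin sklyanin_gen_closed
    unfolding S_def x_def by blast
  \<comment> \<open>For \<open>l \<noteq> j\<close> the image of \<open>x\<^sub>j\<close> is a multiple of some \<open>q\<^sub>m\<close>, so it has trace zero.\<close>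
  moreover have "\<exists>p q r. \<rho>' (x g) = mat2 p q r (- p)"
    using jl \<rho>'(2)
    by (auto simp: g_def gen_images_def values_numeral q\<^sub>1_def q\<^sub>2_def q\<^sub>3_def
        mat2_arith mat2_eq_iff)
  ultimately obtain p q r where "s \<cdot>\<^sub>m 1\<^sub>m 2 = mat2 p q r (- p)" by auto
  then have "s * 1 = p" "s * 1 = - p" unfolding mat2_arith mat2_eq_iff by blast+
  then have "2 * s = 0" by (metis add.right_inverse mult_1_right mult_2)
  then show False using s(2) nz(1) by simp
qed

theorem proposition2p16:
  fixes \<alpha>\<^sub>1 \<alpha>\<^sub>2 \<alpha>\<^sub>3 a b c \<iota> :: "'k::alg_closed_field"
  assumes "CHAR('k) \<noteq> 2" "CHAR('k) \<noteq> 3"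
    and "\<alpha>\<^sub>1 \<notin> {0, 1, - 1}" "\<alpha>\<^sub>2 \<notin> {0, 1, - 1}" "\<alpha>\<^sub>3 \<notin> {0, 1, - 1}"
    and "\<alpha>\<^sub>1 + \<alpha>\<^sub>2 + \<alpha>\<^sub>3 + \<alpha>\<^sub>1 * \<alpha>\<^sub>2 * \<alpha>\<^sub>3 = 0"
    and "a\<^sup>2 = \<alpha>\<^sub>1" "b\<^sup>2 = \<alpha>\<^sub>2" "c\<^sup>2 = \<alpha>\<^sub>3" "\<iota>\<^sup>2 = - 1"
  shows "let S = sklyanin_algebra \<alpha>\<^sub>1 \<alpha>\<^sub>2 \<alpha>\<^sub>3;
             x = sklyanin_gen \<alpha>\<^sub>1 \<alpha>\<^sub>2 \<alpha>\<^sub>3;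
             is_rho = (\<lambda>j \<rho>. \<rho> \<in> alg_hom S (mat_algebra 2) \<and>
               gen_images x \<rho> (rho_values a b c \<iota> j))
         in
           (\<forall>j\<in>{0, 1, 2, 3}. \<exists>!\<rho>. \<rho> \<in> extensional (carrier S) \<and> is_rho j \<rho>) \<and>
           (\<forall>\<rho>. (\<forall>j\<in>{0, 1, 2, 3}. is_rho j (\<rho> j)) \<longrightarrow>
             (let V = (\<lambda>j. rep_module 2 (\<rho> j))
              in
                (\<forall>j\<in>{0, 1, 2, 3}. simple_left_module S (V j) \<and> left_module_of_dim S (V j) 2) \<and>
                (\<forall>j\<in>{0, 1, 2, 3}. \<forall>l\<in>{0, 1, 2, 3}.
                   j \<noteq> l \<longrightarrow> \<not> left_module_iso S (V j) (V l)) \<and>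
                (\<forall>j\<in>{1, 2, 3}. \<forall>\<phi>\<in>alg_aut S. gen_images x \<phi> (phi_values S x a b c \<iota> j) \<longrightarrow>
                   left_module_iso S (V j) (pullback \<phi> (V 0)))))"
proof -
  let ?S = "sklyanin_algebra \<alpha>\<^sub>1 \<alpha>\<^sub>2 \<alpha>\<^sub>3" and ?x = "sklyanin_gen \<alpha>\<^sub>1 \<alpha>\<^sub>2 \<alpha>\<^sub>3"
  let ?is_rho = "\<lambda>j \<rho>. \<rho> \<in> alg_hom ?S (mat_algebra 2) \<and> gen_images ?x \<rho> (rho_values a b c \<iota> j)"
  have two: "(2::'k) \<noteq> 0"
  proof
    assume "(2::'k) = 0"
    then have "CHAR('k) dvd 2" using of_nat_eq_0_iff_char_dvd[where ?'a = 'k, of 2] by simp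
    then have "CHAR('k) = 1 \<or> CHAR('k) = 2" using prime_nat_iff two_is_prime_nat by blast
    then show False using assms(1) CHAR_not_1 by simp
  qed
  have \<alpha>: "\<alpha>\<^sub>1 \<noteq> 0" "\<alpha>\<^sub>2 \<noteq> 0" "\<alpha>\<^sub>3 \<noteq> 0" and abc: "a \<noteq> 0" "b \<noteq> 0" "c \<noteq> 0"
    using assms(3-5,7-9) by auto
  interpret S: k_algebra ?S by (rule k_algebra_sklyanin)
  have unique: "\<exists>!\<rho>. \<rho> \<in> extensional (carrier ?S) \<and> ?is_rho j \<rho>" if j: "j \<in> {0, 1, 2, 3}" for j
  proof (rule ex_ex1I)
    obtain \<rho> where \<rho>: "?is_rho j \<rho>" using rho_exists[OF \<alpha> assms(7-10) j] by blast
    then have "?is_rho j (restrict \<rho> (carrier ?S))"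
      using alg_hom_restrict[OF S.ring_axioms _ S.smult_closed, of \<rho> "mat_algebra 2"]
      by (simp add: gen_images_def sklyanin_gen_closed)
    then show "\<exists>\<rho>. \<rho> \<in> extensional (carrier ?S) \<and> ?is_rho j \<rho>" by blast
  next
    fix \<rho> \<rho>'
    assume "\<rho> \<in> extensional (carrier ?S) \<and> ?is_rho j \<rho>" "\<rho>' \<in> extensional (carrier ?S) \<and> ?is_rho j \<rho>'"
    then show "\<rho> = \<rho>'"
      by (intro extensionalityI[of _ "carrier ?S"]) (auto intro: gen_images_determine_hom[OF _ k_algebra_mat])
  qed
  have iso: "left_module_iso ?S (rep_module 2 \<rho>') (pullback \<phi> (rep_module 2 \<rho>))"
    if "?is_rho 0 \<rho>" "?is_rho j \<rho>'" "j \<in> {1, 2, 3}" "\<phi> \<in> alg_aut ?S"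
      "gen_images ?x \<phi> (phi_values ?S ?x a b c \<iota> j)" for \<rho> \<rho>' j \<phi>
  proof (rule rep_module_iso_pullback)
    fix X assume X: "X \<in> carrier ?S"
    have "\<phi> \<in> alg_hom ?S ?S" using that(4) by (simp add: alg_aut_def)
    then have "\<rho> \<circ> \<phi> \<in> alg_hom ?S (mat_algebra 2)" using that(1) by (blast intro: alg_hom_comp)
    moreover have "gen_images ?x (\<rho> \<circ> \<phi>) (rho_values a b c \<iota> j)"
      using that by (blast intro: rho_0_comp_phi)
    ultimately have "\<rho>' X = (\<rho> \<circ> \<phi>) X"
      using that(2) X by (blast intro: gen_images_determine_hom[OF _ k_algebra_mat])
    then show "\<rho>' X = \<rho> (\<phi> X)" by simp
  qed
  show ?thesis
    unfolding Let_def
  proof (intro conjI allI impI ballI, goal_cases)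
    case (1 j)
    then show ?case by (rule unique)
  next
    case (2 \<rho> j)
    then show ?case using rho_module_simple[OF _ _ _ two assms(10) abc] by blast
  next
    case (3 \<rho> j)
    then show ?case using left_module_of_dim_rep_module[OF k_algebra_sklyanin] by blast
  next
    case (4 \<rho> j l)
    then show ?case using rho_modules_not_iso[OF _ _ _ _ _ _ _ two assms(10)] by blast
  next
    case (5 \<rho> j \<phi>)
    then show ?case using iso[of "\<rho> 0" "\<rho> j" j \<phi>] by blast
  qed
qed

end
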